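(* Let $\Gamma$ be a random edge-labelled graph on $n$ vertices with label probabilities $p_m=p_m(n)$. If $np_6\to\infty$, $np_3\not\to 0$ and $np_2\not\to 0$ as $n\to\infty$ (i.e. $np_3$ does not tend to $0$ and $np_2$ does not tend to $0$), then $W_\Gamma$ is asymptotically almost surely not hyperbolic.
   Context: Random edge-labelled graph: for each $n$, nonnegative numbers $p_m(n)$ ($m=2,3,4,\dots$) are given with $\sum_{m=2}^\infty p_m(n)\le 1$. On a vertex set of size $n$, independently for each pair of vertices, the pair is joined by an edge labelled $m$ with probability $p_m(n)$ for each integer $m\ge2$, and is not joined by an edge with the remaining probability. "Asymptotically almost surely" means with probability tending to $1$ as $n\to\infty$. Coxeter group: if $\Gamma$ has vertices $v_1,\dots,v_n$ and the edge between $v_i$ and $v_j$ (if present) has label $m_{i,j}$, then $W_\Gamma=\langle v_1,\dots,v_n\mid v_i^2,\ (v_iv_j)^{m_{i,j}}\rangle$, with the second type of relator only for adjacent pairs. A group is hyperbolic if its Cayley graph with respect to some (hence any) finite generating set is $\delta$-hyperbolic for some $\delta\ge0$, i.e. in every geodesic triangle the $\delta$-neighborhood of the union of two sides contains the third side.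
   Formalization: "np_3 and np_2 do not tend to 0" is read as liminf np_3 > 0 and liminf np_2 > 0 (bounded away from 0 for large n); the literal reading fails, e.g. p_2=p_3=p_6=1/3 for even n and p_6=1 for odd n, where W_Γ is hyperbolic for odd n. *)

theory Defs
  imports "HOL-Probability.Probability" "HOL-Algebra.Generated_Groups"
begin

section \<open>Group presentations\<close>

text \<open>
  A letter \<open>(x, True)\<close> is the generator \<open>x\<close>; \<open>(x, False)\<close> is its formal inverse.
  The group presented by generators \<open>X\<close> and relators \<open>R\<close> is the monoid of words in these
  letters modulo the least congruence that identifies every relator and every
  \<open>x x\<inverse>\<close>, \<open>x\<inverse> x\<close> with the empty word.
\<close>

definition gen_words :: "'a set \<Rightarrow> ('a \<times> bool) list set" where
  "gen_words X = lists (X \<times> UNIV)"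

inductive_set pres_rel :: "'a set \<Rightarrow> ('a \<times> bool) list set \<Rightarrow> (('a \<times> bool) list \<times> ('a \<times> bool) list) set"
  for X R where
    refl: "w \<in> gen_words X \<Longrightarrow> (w, w) \<in> pres_rel X R"
  | sym: "(u, w) \<in> pres_rel X R \<Longrightarrow> (w, u) \<in> pres_rel X R"
  | trans: "(u, v) \<in> pres_rel X R \<Longrightarrow> (v, w) \<in> pres_rel X R \<Longrightarrow> (u, w) \<in> pres_rel X R"
  | cancel: "u \<in> gen_words X \<Longrightarrow> w \<in> gen_words X \<Longrightarrow> x \<in> X \<Longrightarrow>
      (u @ [(x, b), (x, \<not> b)] @ w, u @ w) \<in> pres_rel X R"
  | relator: "u \<in> gen_words X \<Longrightarrow> w \<in> gen_words X \<Longrightarrow> r \<in> R \<Longrightarrow> r \<in> gen_words X \<Longrightarrow>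
      (u @ r @ w, u @ w) \<in> pres_rel X R"

definition presented_group :: "'a set \<Rightarrow> ('a \<times> bool) list set \<Rightarrow> ('a \<times> bool) list set monoid" where
  "presented_group X R =
    \<lparr>carrier = gen_words X // pres_rel X R,
     mult = (\<lambda>A B. \<Union>a\<in>A. \<Union>b\<in>B. pres_rel X R `` {a @ b}),
     one = pres_rel X R `` {[]}\<rparr>"

lemma pres_rel_words:
  assumes "(u, w) \<in> pres_rel X R"
  shows "u \<in> gen_words X \<and> w \<in> gen_words X"
  using assms by induction (auto simp: gen_words_def)

lemma equiv_pres_rel: "equiv (gen_words X) (pres_rel X R)"
proof (rule equivI)
  show "pres_rel X R \<subseteq> gen_words X \<times> gen_words X"
    using pres_rel_words by fastforce
  show "refl_on (gen_words X) (pres_rel X R)"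
    by (rule refl_onI) (rule pres_rel.refl)
  show "Relation.sym (pres_rel X R)" by (rule symI) (rule pres_rel.sym)
  show "Relation.trans (pres_rel X R)" by (rule transI) (rule pres_rel.trans)
qed

lemma pres_rel_context:
  assumes "(u, w) \<in> pres_rel X R" "a \<in> gen_words X" "b \<in> gen_words X"
  shows "(a @ u @ b, a @ w @ b) \<in> pres_rel X R"
  using assms(1)
proof induction
  case (refl w)
  then show ?case using assms by (intro pres_rel.refl) (auto simp: gen_words_def)
next
  case (sym u w)
  then show ?case by (blast intro: pres_rel.sym)
next
  case (trans u v w)
  then show ?case by (blast intro: pres_rel.trans)
next
  case (cancel u w x c)
  then show ?case
    using pres_rel.cancel[of "a @ u" X "w @ b" x c R] assms by (auto simp: gen_words_def)
next
  case (relator u w r)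
  then show ?case
    using pres_rel.relator[of "a @ u" X "w @ b" r R] assms by (auto simp: gen_words_def)
qed

lemma pres_rel_append:
  assumes "(a, a') \<in> pres_rel X R" "(b, b') \<in> pres_rel X R"
  shows "(a @ b, a' @ b') \<in> pres_rel X R"
proof -
  have nil: "[] \<in> gen_words X" by (simp add: gen_words_def)
  have "(a @ b, a' @ b) \<in> pres_rel X R"
    using pres_rel_context[OF assms(1) nil, of b] pres_rel_words[OF assms(2)] by simp
  moreover have "(a' @ b, a' @ b') \<in> pres_rel X R"
    using pres_rel_context[OF assms(2) _ nil, of a'] pres_rel_words[OF assms(1)] by simp
  ultimately show ?thesis by (rule pres_rel.trans)
qed

lemma presented_group_mult:
  assumes "a \<in> gen_words X" "b \<in> gen_words X"
  shows "(pres_rel X R `` {a}) \<otimes>\<^bsub>presented_group X R\<^esub> (pres_rel X R `` {b}) = pres_rel X R `` {a @ b}"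
proof -
  have "pres_rel X R `` {a' @ b'} = pres_rel X R `` {a @ b}"
    if "(a, a') \<in> pres_rel X R" "(b, b') \<in> pres_rel X R" for a' b'
    using equiv_class_eq[OF equiv_pres_rel pres_rel_append[OF that]] by simp
  then have "(\<Union>a'\<in>pres_rel X R `` {a}. \<Union>b'\<in>pres_rel X R `` {b}. pres_rel X R `` {a' @ b'}) =
      (\<Union>a'\<in>pres_rel X R `` {a}. \<Union>b'\<in>pres_rel X R `` {b}. pres_rel X R `` {a @ b})"
    by simp
  moreover have "pres_rel X R `` {a} \<noteq> {}" "pres_rel X R `` {b} \<noteq> {}"
    using pres_rel.refl[OF assms(1)] pres_rel.refl[OF assms(2)] by blast+
  ultimately show ?thesis by (simp add: presented_group_def)
qed

lemma inverse_word:
  assumes "w \<in> gen_words X"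
  shows "(map (\<lambda>(x, b). (x, \<not> b)) (rev w) @ w, []) \<in> pres_rel X R"
  using assms
proof (induction w)
  case Nil
  then show ?case by (auto intro: pres_rel.refl simp: gen_words_def)
next
  case (Cons l w)
  obtain x b where l: "l = (x, b)" by fastforce
  let ?i = "map (\<lambda>(x, b). (x, \<not> b)) (rev w)"
  have w: "w \<in> gen_words X" "x \<in> X" using Cons.prems l by (auto simp: gen_words_def)
  then have "?i \<in> gen_words X" by (auto simp: gen_words_def)
  then have "(?i @ [(x, \<not> b), (x, \<not> \<not> b)] @ w, ?i @ w) \<in> pres_rel X R"
    using w by (intro pres_rel.cancel) auto
  then have "(?i @ [(x, \<not> b), (x, \<not> \<not> b)] @ w, []) \<in> pres_rel X R"
    using Cons.IH[OF w(1)] by (rule pres_rel.trans)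
  then show ?case using l by simp
qed

lemma group_presented_group: "group (presented_group X R)"
proof (rule groupI)
  let ?G = "presented_group X R"
  have car: "carrier ?G = (\<lambda>w. pres_rel X R `` {w}) ` gen_words X"
    by (auto simp: presented_group_def quotient_def)
  have one: "\<one>\<^bsub>?G\<^esub> = pres_rel X R `` {[]}" by (simp add: presented_group_def)
  have nil: "[] \<in> gen_words X" by (simp add: gen_words_def)
  have app: "a @ b \<in> gen_words X" if "a \<in> gen_words X" "b \<in> gen_words X" for a b
    using that by (auto simp: gen_words_def)
  show "x \<otimes>\<^bsub>?G\<^esub> y \<in> carrier ?G" if "x \<in> carrier ?G" "y \<in> carrier ?G" for x y
    using that app by (auto simp: car presented_group_mult)
  show "\<one>\<^bsub>?G\<^esub> \<in> carrier ?G" using nil by (auto simp: car one)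
  show "x \<otimes>\<^bsub>?G\<^esub> y \<otimes>\<^bsub>?G\<^esub> z = x \<otimes>\<^bsub>?G\<^esub> (y \<otimes>\<^bsub>?G\<^esub> z)"
    if "x \<in> carrier ?G" "y \<in> carrier ?G" "z \<in> carrier ?G" for x y z
    using that app by (auto simp: car presented_group_mult)
  show "\<one>\<^bsub>?G\<^esub> \<otimes>\<^bsub>?G\<^esub> x = x" if "x \<in> carrier ?G" for x
    using that nil by (auto simp: car one presented_group_mult)
  show "\<exists>y\<in>carrier ?G. y \<otimes>\<^bsub>?G\<^esub> x = \<one>\<^bsub>?G\<^esub>" if x: "x \<in> carrier ?G" for x
  proof -
    obtain w where w: "w \<in> gen_words X" "x = pres_rel X R `` {w}" using x by (auto simp: car)
    let ?i = "map (\<lambda>(x, b). (x, \<not> b)) (rev w)"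
    have i: "?i \<in> gen_words X" using w by (auto simp: gen_words_def)
    have "pres_rel X R `` {?i @ w} = pres_rel X R `` {[]}"
      using equiv_class_eq[OF equiv_pres_rel inverse_word[OF w(1)]] .
    then show ?thesis using i w by (auto simp: car one presented_group_mult)
  qed
qed

section \<open>Coxeter groups of edge-labelled graphs\<close>

text \<open>
  An edge-labelled simple graph on the vertex set \<open>V\<close> is given by a map \<open>\<Gamma>\<close> on the
  two-element subsets of \<open>V\<close>: \<open>\<Gamma> {u, v} = Some m\<close> if \<open>u\<close> and \<open>v\<close> are joined by an edge
  with label \<open>m\<close>, and \<open>\<Gamma> {u, v} = None\<close> if they are not joined.
\<close>

definition coxeter_relators :: "'v set \<Rightarrow> ('v set \<Rightarrow> nat option) \<Rightarrow> ('v \<times> bool) list set" where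
  "coxeter_relators V \<Gamma> =
     {[(v, True), (v, True)] | v. v \<in> V} \<union>
     {concat (replicate m [(u, True), (v, True)]) | u v m.
        u \<in> V \<and> v \<in> V \<and> u \<noteq> v \<and> \<Gamma> {u, v} = Some m}"

definition coxeter_group :: "'v set \<Rightarrow> ('v set \<Rightarrow> nat option) \<Rightarrow> ('v \<times> bool) list set monoid" where
  "coxeter_group V \<Gamma> = presented_group V (coxeter_relators V \<Gamma>)"

section \<open>Simple graphs as metric spaces\<close>

text \<open>A simple graph has vertex set \<open>V\<close> and a set \<open>E\<close> of two-element subsets of \<open>V\<close> as edges.\<close>

definition graph_dist :: "'v set set \<Rightarrow> 'v \<Rightarrow> 'v \<Rightarrow> nat" where
  "graph_dist E u v = (LEAST k. (u, v) \<in> {(a, b). {a, b} \<in> E} ^^ k)"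

text \<open>
  Points of the geometric realisation in barycentric coordinates: nonnegative weights of sum 1
  supported on a vertex or on the two ends of an edge. Edges have length 1, so the point \<open>x\<close> of an
  edge \<open>{u, v}\<close> lies at distance \<open>x v = 1 - x u\<close> from \<open>u\<close>.
\<close>

definition graph_points :: "'v set \<Rightarrow> 'v set set \<Rightarrow> ('v \<Rightarrow> real) set" where
  "graph_points V E =
     {x. (\<forall>v. 0 \<le> x v) \<and>
         (\<exists>s \<in> E \<union> {{v} | v. v \<in> V}. (\<forall>v. v \<notin> s \<longrightarrow> x v = 0) \<and> (\<Sum>v\<in>s. x v) = 1)}"

text \<open>
  The path metric of the realisation of a connected graph. On a common edge it is the length of the
  interval between the two points; otherwise a shortest path leaves \<open>x\<close> through an end \<open>u\<close> of its
  edge and reaches \<open>y\<close> through an end \<open>v\<close> of its edge.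
\<close>

definition graph_metric :: "'v set set \<Rightarrow> ('v \<Rightarrow> real) \<Rightarrow> ('v \<Rightarrow> real) \<Rightarrow> real" where
  "graph_metric E x y =
     (if \<exists>e\<in>E. {v. x v \<noteq> 0} \<union> {v. y v \<noteq> 0} \<subseteq> e
      then (\<Sum>v\<in>{v. x v \<noteq> 0} \<union> {v. y v \<noteq> 0}. \<bar>x v - y v\<bar>) / 2
      else Min {(1 - x u) + real (graph_dist E u v) + (1 - y v) | u v. x u \<noteq> 0 \<and> y v \<noteq> 0})"

section \<open>Hyperbolicity\<close>

definition geodesic_segment :: "'p set \<Rightarrow> ('p \<Rightarrow> 'p \<Rightarrow> real) \<Rightarrow> 'p \<Rightarrow> 'p \<Rightarrow> 'p set \<Rightarrow> bool" where
  "geodesic_segment M d x y A \<longleftrightarrow>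
     (\<exists>\<gamma> L. 0 \<le> L \<and> \<gamma> 0 = x \<and> \<gamma> L = y \<and> \<gamma> ` {0..L} = A \<and> A \<subseteq> M \<and>
        (\<forall>s\<in>{0..L}. \<forall>t\<in>{0..L}. d (\<gamma> s) (\<gamma> t) = \<bar>s - t\<bar>))"

text \<open>
  It suffices to constrain the side from \<open>x\<close> to \<open>y\<close>, as \<open>x\<close>, \<open>y\<close>, \<open>z\<close> range over all triples.
\<close>

definition delta_hyperbolic :: "'p set \<Rightarrow> ('p \<Rightarrow> 'p \<Rightarrow> real) \<Rightarrow> real \<Rightarrow> bool" where
  "delta_hyperbolic M d \<delta> \<longleftrightarrow>
     (\<forall>x\<in>M. \<forall>y\<in>M. \<forall>z\<in>M. \<forall>A B C.
        geodesic_segment M d x y A \<and> geodesic_segment M d y z B \<and> geodesic_segment M d z x C \<longrightarrow>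
        (\<forall>a\<in>A. \<exists>b\<in>B \<union> C. d a b \<le> \<delta>))"

definition cayley_edges :: "('g, 'b) monoid_scheme \<Rightarrow> 'g set \<Rightarrow> 'g set set" where
  "cayley_edges G S =
     {{g, g \<otimes>\<^bsub>G\<^esub> s} | g s. g \<in> carrier G \<and> s \<in> S \<and> g \<otimes>\<^bsub>G\<^esub> s \<noteq> g}"

definition hyperbolic_group :: "('g, 'b) monoid_scheme \<Rightarrow> bool" where
  "hyperbolic_group G \<longleftrightarrow>
     (\<exists>S. finite S \<and> S \<subseteq> carrier G \<and> generate G S = carrier G \<and>
        (\<exists>\<delta>\<ge>0. delta_hyperbolic (graph_points (carrier G) (cayley_edges G S))
                  (graph_metric (cayley_edges G S)) \<delta>))"

section \<open>Random edge-labelled graphs\<close>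

text \<open>\<open>q m\<close> is the probability of the label \<open>m\<close>; values of \<open>q\<close> below 2 are ignored.\<close>

definition label_pmf :: "(nat \<Rightarrow> real) \<Rightarrow> nat option pmf" where
  "label_pmf q = embed_pmf (\<lambda>l. case l of
      None \<Rightarrow> 1 - (\<Sum>\<^sub>\<infinity>m\<in>{2..}. q m)
    | Some m \<Rightarrow> if m \<ge> 2 then q m else 0)"

definition label_probabilities :: "(nat \<Rightarrow> real) \<Rightarrow> bool" where
  "label_probabilities q \<longleftrightarrow>
     (\<forall>m\<ge>2. 0 \<le> q m) \<and> q summable_on {2..} \<and> (\<Sum>\<^sub>\<infinity>m\<in>{2..}. q m) \<le> 1"

lemma pmf_label_pmf:
  assumes "label_probabilities q"
  shows "pmf (label_pmf q) None = 1 - (\<Sum>\<^sub>\<infinity>m\<in>{2..}. q m)"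
    and "pmf (label_pmf q) (Some m) = (if m \<ge> 2 then q m else 0)"
proof -
  let ?r = "\<lambda>m. if m \<ge> 2 then q m else 0"
  let ?s = "\<Sum>\<^sub>\<infinity>m\<in>{2..}. q m"
  let ?f = "\<lambda>l. case l of None \<Rightarrow> 1 - ?s | Some m \<Rightarrow> ?r m"
  have q: "\<And>m. m \<ge> 2 \<Longrightarrow> 0 \<le> q m" "q summable_on {2..}" "?s \<le> 1"
    using assms by (auto simp: label_probabilities_def)
  have "(q has_sum ?s) {2..}" using q(2) by (rule has_sum_infsum)
  then have "(?r has_sum ?s) UNIV"
    by (subst has_sum_cong_neutral[where T = "{2..}" and g = q]) auto
  then have sums: "?r sums ?s" by (rule has_sum_imp_sums)
  have s0: "0 \<le> ?s" using q(1) by (intro infsum_nonneg) auto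
  have nn: "0 \<le> ?f l" for l using q by (auto split: option.split)
  have "(\<integral>\<^sup>+ m. ennreal (?r m) \<partial>count_space UNIV) = ennreal ?s"
    using sums q(1) by (simp add: nn_integral_count_space_nat suminf_ennreal2 sums_iff)
  then have "(\<integral>\<^sup>+ l. ennreal (?f l) \<partial>count_space (range Some)) = ennreal ?s"
    by (subst nn_integral_bij_count_space[where g = Some and A = UNIV, symmetric])
       (auto simp: bij_betw_def)
  moreover have "(\<integral>\<^sup>+ l. ennreal (?f l) \<partial>count_space UNIV) =
      ennreal (1 - ?s) + (\<integral>\<^sup>+ l. ennreal (?f l) \<partial>count_space (range Some))"
  proof -
    have "(\<integral>\<^sup>+ l. ennreal (?f l) \<partial>count_space UNIV) =
      (\<integral>\<^sup>+ l. ennreal (?f l) * indicator {None} l + ennreal (?f l) * indicator (range Some) l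
        \<partial>count_space UNIV)"
      by (intro nn_integral_cong) (auto split: option.split simp: indicator_def)
    also have "\<dots> = ennreal (1 - ?s) + (\<integral>\<^sup>+ l. ennreal (?f l) \<partial>count_space (range Some))"
      by (subst nn_integral_add) (auto simp: nn_integral_count_space_indicator[of "range Some"])
    finally show ?thesis .
  qed
  ultimately have one: "(\<integral>\<^sup>+ l. ennreal (?f l) \<partial>count_space UNIV) = 1"
    using s0 q(3) by (simp flip: ennreal_plus)
  show "pmf (label_pmf q) None = 1 - ?s" "pmf (label_pmf q) (Some m) = ?r m"
    unfolding label_pmf_def by (simp_all add: pmf_embed_pmf[OF nn one])
qed

text \<open>
  The labels of distinct pairs are independent; arguments that are not pairs of vertices get the
  default value \<open>None\<close>.
\<close>

definition random_graph :: "nat \<Rightarrow> (nat \<Rightarrow> real) \<Rightarrow> (nat set \<Rightarrow> nat option) pmf" where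
  "random_graph n q = Pi_pmf {e. e \<subseteq> {..<n} \<and> card e = 2} None (\<lambda>_. label_pmf q)"

text \<open>\<open>\<mu> n\<close> is the distribution of the \<open>n\<close>-th random object.\<close>

definition asymptotically_almost_surely :: "(nat \<Rightarrow> 'a pmf) \<Rightarrow> (nat \<Rightarrow> 'a \<Rightarrow> bool) \<Rightarrow> bool" where
  "asymptotically_almost_surely \<mu> P \<longleftrightarrow>
     (\<lambda>n. measure_pmf.prob (\<mu> n) {x. P n x}) \<longlonglongrightarrow> 1"

end

theory Submission
  imports Defs "HOL-Real_Asymp.Real_Asymp"
begin

text \<open>
A Coxeter group fails to be hyperbolic as soon as its graph contains a triangle with labels 2, 3 and 6, and
under the hypotheses such a triangle exists with probability tending to 1.

For the existence of the triangle, the expected number of these triangles is of order \<open>n\<^sup>3 p\<^sub>2 p\<^sub>3 p\<^sub>6\<close>. It tends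
to infinity, since \<open>n p\<^sub>2\<close> and \<open>n p\<^sub>3\<close> are bounded below and \<open>n p\<^sub>6\<close> tends to infinity, and the second moment method
(\<open>prob_no_triangle_le\<close>) shows that the number concentrates around its mean.

The three corners of such a triangle act as the reflections in the sides of a Euclidean triangle, and the
translations generated by them form a hexagonal lattice. Let \<open>g\<close> be a nontrivial one of these translations and \<open>h\<close> its conjugate by
a rotation by a sixth of a full turn. Then \<open>g\<close>, \<open>h\<close> and \<open>g h\<inverse>\<close> are conjugate and commute. In a
hyperbolic group, the four-point inequality (\<open>four_point\<close>) for the parallelograms spanned by powers of \<open>g\<close> and \<open>h\<close> makes the
word length of \<open>g\<^sup>2\<^sup>n\<close> exceed that of \<open>g\<^sup>n\<close> by a bounded amount only, hence the length of \<open>g\<^sup>n\<close> would grow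
at most logarithmically along the powers of 2 (\<open>hexagonal_lattice_not_hyperbolic\<close>).

The length of \<open>g\<^sup>n\<close> in the whole Coxeter group grows linearly, however. The reason is the count of walls: for
every word, the reflections that it crosses an odd number of times depend only on the group element, because every
relator crosses each reflection an even number of times (\<open>inversions_pres_rel\<close>). The number of these reflections is subadditive, and the
Tits representation, which restricts to the span of three basis vectors, shows that the \<open>n\<close> translates of one
wall are all crossed by \<open>g\<^sup>n\<close> (\<open>translation_length\<close>).
\<close>

section \<open>The four-point inequality in hyperbolic graphs\<close>

definition adjacency :: "'v set set \<Rightarrow> ('v \<times> 'v) set" where
  "adjacency E = {(a, b). {a, b} \<in> E}"

lemma graph_dist_adjacency: "graph_dist E u v = (LEAST k. (u, v) \<in> adjacency E ^^ k)"
  by (simp add: graph_dist_def adjacency_def)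

lemma sym_adjacency: "sym (adjacency E)"
  by (auto simp: sym_def adjacency_def insert_commute)

locale connected_graph =
  fixes V :: "'v set" and E :: "'v set set"
  assumes edges: "e \<in> E \<Longrightarrow> \<exists>u v. u \<in> V \<and> v \<in> V \<and> u \<noteq> v \<and> e = {u, v}"
    and connected: "u \<in> V \<Longrightarrow> v \<in> V \<Longrightarrow> (u, v) \<in> (adjacency E)\<^sup>*"
begin

lemma adjacency_graph_dist:
  assumes "u \<in> V" "v \<in> V"
  shows "(u, v) \<in> adjacency E ^^ graph_dist E u v"
  unfolding graph_dist_adjacency
  using rtrancl_imp_relpow[OF connected[OF assms]] by (auto intro: LeastI)

lemma graph_dist_le: "(u, v) \<in> adjacency E ^^ k \<Longrightarrow> graph_dist E u v \<le> k"
  unfolding graph_dist_adjacency by (rule Least_le)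

lemma graph_dist_edge_le: "{u, v} \<in> E \<Longrightarrow> graph_dist E u v \<le> 1"
  by (rule graph_dist_le) (auto simp: adjacency_def)

lemma graph_dist_same [simp]: "graph_dist E u u = 0"
  using graph_dist_le[of u u 0] by simp

lemma graph_dist_commute: "graph_dist E u v = graph_dist E v u"
proof -
  have "(u, v) \<in> adjacency E ^^ k \<longleftrightarrow> (v, u) \<in> adjacency E ^^ k" for k
  proof -
    have sub: "(b, a) \<in> adjacency E ^^ k" if "(a, b) \<in> adjacency E ^^ k" for a b
      using that
    proof (induction k arbitrary: b)
      case (Suc k)
      then obtain c where "(a, c) \<in> adjacency E ^^ k" "(c, b) \<in> adjacency E" by auto
      then show ?case using Suc.IH[of c] sym_adjacency[of E] by (meson relpow_Suc_I2 symD)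
    qed simp
    then show ?thesis by blast
  qed
  then show ?thesis unfolding graph_dist_adjacency by simp
qed

lemma graph_dist_triangle:
  assumes "u \<in> V" "v \<in> V" "w \<in> V"
  shows "graph_dist E u w \<le> graph_dist E u v + graph_dist E v w"
  using adjacency_graph_dist[OF assms(1,2)] adjacency_graph_dist[OF assms(2,3)]
  by (intro graph_dist_le) (auto simp: relpow_add)

lemma graph_dist_eq_1: "u \<in> V \<Longrightarrow> v \<in> V \<Longrightarrow> graph_dist E u v = 1 \<Longrightarrow> {u, v} \<in> E"
  using adjacency_graph_dist[of u v] by (simp add: adjacency_def)

lemma edge_subset_dist_le:
  assumes "e \<in> E" "u \<in> e" "v \<in> e"
  shows "graph_dist E u v \<le> 1"
  using edges[OF assms(1)] assms graph_dist_edge_le by (auto simp: insert_commute)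

definition geodesic_path :: "(nat \<Rightarrow> 'v) \<Rightarrow> nat \<Rightarrow> 'v \<Rightarrow> 'v \<Rightarrow> bool" where
  "geodesic_path c L u v \<longleftrightarrow> c 0 = u \<and> c L = v \<and> c ` {..L} \<subseteq> V \<and>
     (\<forall>i\<le>L. \<forall>j\<le>L. real (graph_dist E (c i) (c j)) = \<bar>real i - real j\<bar>)"

lemma geodesic_path_exists:
  assumes "u \<in> V" "v \<in> V"
  shows "\<exists>c. geodesic_path c (graph_dist E u v) u v"
proof -
  define L where "L = graph_dist E u v"
  obtain c where c: "c 0 = u" "c L = v" "\<And>i. i < L \<Longrightarrow> (c i, c (Suc i)) \<in> adjacency E"
    using adjacency_graph_dist[OF assms] unfolding L_def relpow_fun_conv by blast
  have V: "c i \<in> V" if "i \<le> L" for i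
  proof (cases i)
    case (Suc j)
    then have "{c j, c i} \<in> E" using c(3)[of j] that by (auto simp: adjacency_def)
    then obtain a b where "a \<in> V" "b \<in> V" "{c j, c i} = {a, b}" using edges by blast
    then show ?thesis by (auto simp: doubleton_eq_iff)
  qed (use c assms in auto)
  have le: "graph_dist E (c i) (c j) \<le> j - i" if "i \<le> j" "j \<le> L" for i j
  proof -
    have "(c i, c j) \<in> adjacency E ^^ (j - i)"
      unfolding relpow_fun_conv using that c(3) by (intro exI[of _ "\<lambda>k. c (i + k)"]) auto
    then show ?thesis by (rule graph_dist_le)
  qed
  have eq: "graph_dist E (c i) (c j) = j - i" if "i \<le> j" "j \<le> L" for i j
  proof -
    have "L \<le> graph_dist E u (c i) + graph_dist E (c i) v"
      using graph_dist_triangle[of u "c i" v] V assms that by (simp add: L_def)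
    also have "\<dots> \<le> graph_dist E u (c i) + (graph_dist E (c i) (c j) + graph_dist E (c j) v)"
      using graph_dist_triangle[of "c i" "c j" v] V assms that by simp
    finally have "L \<le> i + graph_dist E (c i) (c j) + (L - j)"
      using le[of 0 i] le[of j L] c that by simp
    then show ?thesis using le[OF that] that by simp
  qed
  have "real (graph_dist E (c i) (c j)) = \<bar>real i - real j\<bar>" if "i \<le> L" "j \<le> L" for i j
    using eq[of i j] eq[of j i] graph_dist_commute[of "c i" "c j"] that
    by (cases "i \<le> j") (auto simp: of_nat_diff)
  then show ?thesis using c V unfolding geodesic_path_def L_def by blast
qed

lemma geodesic_path_inj: "geodesic_path c L u v \<Longrightarrow> inj_on c {..L}"
  unfolding geodesic_path_def by (intro inj_onI) (metis abs_0_eq atMost_iff eq_iff_diff_eq_0 graph_dist_same of_nat_0 of_nat_eq_iff)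

text \<open>
The point at distance \<open>s\<close> from the start of a geodesic path, in barycentric coordinates. Its weight
at the vertex number \<open>i\<close> is the tent function centred at \<open>i\<close>, which treats vertices and inner points of
edges alike. Vertices are located on the path through \<open>inv_into\<close>, since geodesic paths are injective.
\<close>

definition hat :: "(nat \<Rightarrow> 'v) \<Rightarrow> nat \<Rightarrow> real \<Rightarrow> 'v \<Rightarrow> real" where
  "hat c L s v = (if v \<in> c ` {..L} then max 0 (1 - \<bar>s - real (inv_into {..L} c v)\<bar>) else 0)"

lemma hat_path:
  assumes "geodesic_path c L u v" "i \<le> L"
  shows "hat c L s (c i) = max 0 (1 - \<bar>s - real i\<bar>)"
  using assms inv_into_f_f[OF geodesic_path_inj[OF assms(1)]] by (simp add: hat_def)

lemma hat_support:
  assumes "geodesic_path c L u v" "hat c L s w \<noteq> 0"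
  shows "\<exists>i\<le>L. w = c i \<and> \<bar>s - real i\<bar> < 1 \<and> hat c L s w = 1 - \<bar>s - real i\<bar>"
proof -
  obtain i where "i \<le> L" "w = c i" using assms(2) by (auto simp: hat_def split: if_splits)
  then show ?thesis using hat_path[OF assms(1)] assms(2) by (intro exI[of _ i]) auto
qed

lemma geodesic_path_edge:
  assumes "geodesic_path c L u v" "i < L"
  shows "{c i, c (Suc i)} \<in> E" and "c i \<noteq> c (Suc i)"
proof -
  have "real (graph_dist E (c i) (c (Suc i))) = 1" "c i \<in> V" "c (Suc i) \<in> V"
    using assms unfolding geodesic_path_def by auto
  then show "{c i, c (Suc i)} \<in> E" using graph_dist_eq_1 by auto
  then show "c i \<noteq> c (Suc i)" using edges by force
qed

lemma hat_graph_points: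
  assumes c: "geodesic_path c L u v" and s: "0 \<le> s" "s \<le> real L"
  shows "hat c L s \<in> graph_points V E"
proof -
  define k where "k = nat \<lfloor>s\<rfloor>"
  have k: "real k \<le> s" "s < real k + 1" "k \<le> L" unfolding k_def using s by linarith+
  have nn: "\<forall>v. 0 \<le> hat c L s v" by (simp add: hat_def)
  show ?thesis
  proof (cases "k = L")
    case True
    then have "s = real L" using k s by simp
    have 1: "\<forall>v. v \<notin> {c L} \<longrightarrow> hat c L s v = 0"
    proof (intro allI impI, rule ccontr)
      fix v assume v: "v \<notin> {c L}" "hat c L s v \<noteq> 0"
      then obtain i where i: "i \<le> L" "v = c i" "\<bar>s - real i\<bar> < 1"
        using hat_support[OF c] by blast
      then have "i = L" using \<open>s = real L\<close> by linarith
      then show False using v i by auto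
    qed
    have 2: "(\<Sum>v\<in>{c L}. hat c L s v) = 1" using hat_path[OF c, of L] \<open>s = real L\<close> by simp
    have "c L \<in> V" using c by (auto simp: geodesic_path_def)
    then show ?thesis unfolding graph_points_def using nn 1 2 by blast
  next
    case False
    then have kL: "k < L" using k by simp
    have 1: "\<forall>v. v \<notin> {c k, c (Suc k)} \<longrightarrow> hat c L s v = 0"
    proof (intro allI impI, rule ccontr)
      fix v assume v: "v \<notin> {c k, c (Suc k)}" "hat c L s v \<noteq> 0"
      then obtain i where i: "i \<le> L" "v = c i" "\<bar>s - real i\<bar> < 1"
        using hat_support[OF c] by blast
      then have "i = k \<or> i = Suc k" using k by linarith
      then show False using v i by auto
    qed
    have 2: "(\<Sum>v\<in>{c k, c (Suc k)}. hat c L s v) = 1"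
      using hat_path[OF c, of k s] hat_path[OF c, of "Suc k" s] geodesic_path_edge[OF c kL] kL k by simp
    show ?thesis unfolding graph_points_def using nn 1 2 geodesic_path_edge[OF c kL] by blast
  qed
qed

text \<open>
Points in a common unit interval \<open>[k, k + 1]\<close> are compared by the first clause of the metric. For
all other pairs the vertices of the path that enclose the two points are at distance at least 2, so no edge carries both points and the
minimum in the second clause applies: the triangle inequality on the line bounds it from below, and it
is attained at the two vertices of the path that face each other.
\<close>

lemma graph_metric_hat_le:
  assumes c: "geodesic_path c L u v" and st: "0 \<le> s" "s \<le> t" "t \<le> real L"
  shows "graph_metric E (hat c L s) (hat c L t) = t - s"
proof -
  define k where "k = nat \<lfloor>s\<rfloor>"
  define l where "l = nat \<lceil>t\<rceil>"
  have k: "real k \<le> s" "s < real k + 1" "k \<le> L" unfolding k_def using st by linarith+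
  have l: "t \<le> real l" "real l < t + 1" "l \<le> L" unfolding l_def using st by linarith+
  let ?x = "hat c L s" and ?y = "hat c L t"
  let ?U = "{v. ?x v \<noteq> 0} \<union> {v. ?y v \<noteq> 0}"
  have dist: "real (graph_dist E (c i) (c j)) = \<bar>real i - real j\<bar>" if "i \<le> L" "j \<le> L" for i j
    using c that by (auto simp: geodesic_path_def)
  show ?thesis
  proof (cases "l \<le> Suc k")
    case near: True
    show ?thesis
    \<comment> \<open>The end of the path has to be treated apart: a path of length 0 need not meet any edge.\<close>
    proof (cases "k = L")
      case True
      then have s: "s = real L" "t = real L" using k st by auto
      have sub: "?U \<subseteq> {c L}"
      proof
        fix w assume "w \<in> ?U"
        then obtain i where i: "i \<le> L" "w = c i" "\<bar>real L - real i\<bar> < 1"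
          using hat_support[OF c] unfolding s by blast
        then have "i = L" by linarith
        then show "w \<in> {c L}" using i by simp
      qed
      show ?thesis
      proof (cases "\<exists>e\<in>E. ?U \<subseteq> e")
        case True then show ?thesis by (simp add: graph_metric_def s)
      next
        case False
        have "?x w \<noteq> 0 \<longleftrightarrow> w = c L" for w
          using hat_path[OF c, of L] sub s by auto
        then have "{(1 - ?x u) + real (graph_dist E u v) + (1 - ?y v) | u v. ?x u \<noteq> 0 \<and> ?y v \<noteq> 0} = {0}"
          using hat_path[OF c, of L s] unfolding s by auto
        then show ?thesis using False by (simp add: graph_metric_def s)
      qed
    next
      case False
      then have kL: "k < L" using k by simp
      have sub: "?U \<subseteq> {c k, c (Suc k)}"
      proof
        fix w assume "w \<in> ?U"
        then obtain i where i: "i \<le> L" "w = c i" "\<bar>s - real i\<bar> < 1 \<or> \<bar>t - real i\<bar> < 1"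
          using hat_support[OF c] by blast
        have "t \<le> real k + 1" using near l by linarith
        then have "i = k \<or> i = Suc k" using i(3) k st by linarith
        then show "w \<in> {c k, c (Suc k)}" using i by auto
      qed
      then have "graph_metric E ?x ?y = (\<Sum>w\<in>?U. \<bar>?x w - ?y w\<bar>) / 2"
        unfolding graph_metric_def using geodesic_path_edge[OF c kL] by auto
      also have "(\<Sum>w\<in>?U. \<bar>?x w - ?y w\<bar>) = (\<Sum>w\<in>{c k, c (Suc k)}. \<bar>?x w - ?y w\<bar>)"
        by (rule sum.mono_neutral_left[OF _ sub]) auto
      also have "\<dots> = 2 * (t - s)"
      proof -
        have t: "t \<le> real k + 1" using near l by linarith
        have "?x (c k) = 1 - (s - k)" "?x (c (Suc k)) = s - k" "?y (c k) = 1 - (t - k)" "?y (c (Suc k)) = t - k"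
          using hat_path[OF c, of k] hat_path[OF c, of "Suc k"] kL k st t by auto
        then show ?thesis using geodesic_path_edge(2)[OF c kL] st by simp
      qed
      finally show ?thesis by simp
    qed
  next
    case far: False
    have ck: "?x (c k) \<noteq> 0" "?y (c l) \<noteq> 0"
      using hat_path[OF c k(3), of s] hat_path[OF c l(3), of t] k l by auto
    have "\<not> (\<exists>e\<in>E. ?U \<subseteq> e)"
    proof
      assume "\<exists>e\<in>E. ?U \<subseteq> e"
      then have "graph_dist E (c k) (c l) \<le> 1" using edge_subset_dist_le ck by blast
      then show False using dist[OF k(3) l(3)] far by linarith
    qed
    then have "graph_metric E ?x ?y =
        Min {(1 - ?x u) + real (graph_dist E u v) + (1 - ?y v) | u v. ?x u \<noteq> 0 \<and> ?y v \<noteq> 0}"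
      by (simp only: graph_metric_def if_False)
    also have "\<dots> = t - s"
    proof (rule Min_eqI)
      have "finite {v. hat c L r v \<noteq> 0}" for r
        by (rule finite_subset[of _ "c ` {..L}"]) (auto simp: hat_def split: if_splits)
      then have "finite ((\<lambda>(u, v). (1 - ?x u) + real (graph_dist E u v) + (1 - ?y v)) `
          ({u. ?x u \<noteq> 0} \<times> {v. ?y v \<noteq> 0}))"
        by (intro finite_imageI finite_cartesian_product)
      then show "finite {(1 - ?x u) + real (graph_dist E u v) + (1 - ?y v) | u v. ?x u \<noteq> 0 \<and> ?y v \<noteq> 0}"
        by (rule back_subst[of finite]) (auto simp: image_iff)
    next
      fix y assume "y \<in> {(1 - ?x u) + real (graph_dist E u v) + (1 - ?y v) | u v. ?x u \<noteq> 0 \<and> ?y v \<noteq> 0}"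
      then obtain u v where y: "y = (1 - ?x u) + real (graph_dist E u v) + (1 - ?y v)" "?x u \<noteq> 0" "?y v \<noteq> 0"
        by blast
      obtain i j where "i \<le> L" "u = c i" "?x u = 1 - \<bar>s - real i\<bar>"
          "j \<le> L" "v = c j" "?y v = 1 - \<bar>t - real j\<bar>"
        using hat_support[OF c y(2)] hat_support[OF c y(3)] by blast
      then show "t - s \<le> y" using dist[of i j] y(1) by simp
    next
      \<comment> \<open>The vertices next to the two points on the inner side.\<close>
      define i where "i = nat \<lceil>s\<rceil>"
      define j where "j = nat \<lfloor>t\<rfloor>"
      have i: "s \<le> real i" "real i < s + 1" "i \<le> L" unfolding i_def using st by linarith+
      have j: "real j \<le> t" "t < real j + 1" "j \<le> L" unfolding j_def using st by linarith+
      have "i \<le> Suc k" "l \<le> Suc j" using i(2) k(2) j(2) l(2) by linarith+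
      then have ij: "i \<le> j" using far by simp
      have "?x (c i) = 1 - (i - s)" "?y (c j) = 1 - (t - j)"
        using hat_path[OF c i(3)] hat_path[OF c j(3)] i j by auto
      then show "t - s \<in> {(1 - ?x u) + real (graph_dist E u v) + (1 - ?y v) | u v. ?x u \<noteq> 0 \<and> ?y v \<noteq> 0}"
        using dist[OF i(3) j(3)] ij i j
        by (intro CollectI exI[of _ "c i"] exI[of _ "c j"]) auto
    qed
    finally show ?thesis .
  qed
qed

lemma graph_metric_commute: "graph_metric E x y = graph_metric E y x"
proof -
  have *: "{(1 - x u) + real (graph_dist E u v) + (1 - y v) | u v. x u \<noteq> 0 \<and> y v \<noteq> 0} =
      {(1 - y u) + real (graph_dist E u v) + (1 - x v) | u v. y u \<noteq> 0 \<and> x v \<noteq> 0}" (is "?A = ?B")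
  proof (intro subset_antisym subsetI)
    fix r assume "r \<in> ?A"
    then obtain u v where "r = (1 - x u) + real (graph_dist E u v) + (1 - y v)" "x u \<noteq> 0" "y v \<noteq> 0" by blast
    then show "r \<in> ?B" by (intro CollectI exI[of _ v] exI[of _ u]) (simp add: graph_dist_commute[of u v])
  next
    fix r assume "r \<in> ?B"
    then obtain u v where "r = (1 - y u) + real (graph_dist E u v) + (1 - x v)" "y u \<noteq> 0" "x v \<noteq> 0" by blast
    then show "r \<in> ?A" by (intro CollectI exI[of _ v] exI[of _ u]) (simp add: graph_dist_commute[of u v])
  qed
  have "{v. x v \<noteq> 0} \<union> {v. y v \<noteq> 0} = {v. y v \<noteq> 0} \<union> {v. x v \<noteq> 0}" by blast
  moreover have "\<bar>x v - y v\<bar> = \<bar>y v - x v\<bar>" for v by simp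
  ultimately show ?thesis unfolding graph_metric_def * by presburger
qed

text \<open>
Geodesic paths of vertices give geodesic segments of the realisation, so that hyperbolicity can be
applied to triangles with vertices of the graph as corners.
\<close>

lemma geodesic_segment_hat:
  assumes c: "geodesic_path c L u v"
  shows "geodesic_segment (graph_points V E) (graph_metric E) (hat c L 0) (hat c L (real L)) (hat c L ` {0..real L})"
proof -
  have "graph_metric E (hat c L s) (hat c L t) = \<bar>s - t\<bar>" if "s \<in> {0..real L}" "t \<in> {0..real L}" for s t
    using graph_metric_hat_le[OF c, of s t] graph_metric_hat_le[OF c, of t s] that
      graph_metric_commute[of "hat c L s" "hat c L t"] by (cases "s \<le> t") auto
  moreover have "hat c L ` {0..real L} \<subseteq> graph_points V E" using hat_graph_points[OF c] by auto
  ultimately show ?thesis unfolding geodesic_segment_def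
    by (intro exI[of _ "hat c L"] exI[of _ "real L"]) auto
qed

lemma hat_vertex:
  assumes "geodesic_path c L u v" "i \<le> L"
  shows "hat c L (real i) = indicator {c i}"
proof
  fix w
  show "hat c L (real i) w = indicator {c i} w"
  proof (cases "w = c i")
    case False
    have "hat c L (real i) w = 0"
    proof (rule ccontr)
      assume "hat c L (real i) w \<noteq> 0"
      then obtain j where j: "w = c j" "\<bar>real i - real j\<bar> < 1" using hat_support[OF assms(1)] by blast
      then have "j = i" by linarith
      then show False using j False by simp
    qed
    then show ?thesis using False by simp
  qed (use hat_path[OF assms] in simp)
qed

text \<open>
Moving from a point of a segment to an end of its edge costs at most 1.
\<close>

lemma graph_metric_vertex:
  assumes c: "geodesic_path c L u v" and s: "s \<in> {0..real L}"
    and le: "graph_metric E (indicator {a}) (hat c L s) \<le> \<delta>" and "0 \<le> \<delta>"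
  shows "\<exists>j\<le>L. real (graph_dist E a (c j)) \<le> \<delta> + 1"
proof (cases "\<exists>e\<in>E. {w. indicator {a} w \<noteq> (0::real)} \<union> {w. hat c L s w \<noteq> 0} \<subseteq> e")
  case True
  then obtain e where e: "e \<in> E" "{w. indicator {a} w \<noteq> (0::real)} \<union> {w. hat c L s w \<noteq> 0} \<subseteq> e" by blast
  define j where "j = nat \<lfloor>s\<rfloor>"
  have j: "real j \<le> s" "s < real j + 1" "j \<le> L" unfolding j_def using s by auto linarith+
  then have "hat c L s (c j) \<noteq> 0" using hat_path[OF c, of j] by simp
  then have "a \<in> e" "c j \<in> e" using e(2) by (auto simp: indicator_def)
  then have "graph_dist E a (c j) \<le> 1" using edge_subset_dist_le e(1) by blast
  then show ?thesis using j \<open>0 \<le> \<delta>\<close> by (intro exI[of _ j]) linarith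
next
  case False
  let ?A = "{(1 - indicator {a} u) + real (graph_dist E u v) + (1 - hat c L s v) | u v. indicator {a} u \<noteq> (0::real) \<and> hat c L s v \<noteq> 0}"
  have A: "?A = (\<lambda>v. real (graph_dist E a v) + (1 - hat c L s v)) ` {v. hat c L s v \<noteq> 0}"
    by (auto simp: indicator_def)
  have "{v. hat c L s v \<noteq> 0} \<subseteq> c ` {..L}" by (auto simp: hat_def split: if_splits)
  then have "finite {v. hat c L s v \<noteq> 0}" by (rule finite_subset) simp
  then have "finite ?A" unfolding A by (rule finite_imageI)
  moreover have "?A \<noteq> {}"
  proof -
    define j where "j = nat \<lfloor>s\<rfloor>"
    have j: "real j \<le> s" "s < real j + 1" "j \<le> L" unfolding j_def using s by auto linarith+
    then have "hat c L s (c j) \<noteq> 0" using hat_path[OF c, of j] by simp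
    then show ?thesis unfolding A by blast
  qed
  ultimately have "Min ?A \<in> ?A" by (rule Min_in)
  moreover have "graph_metric E (indicator {a}) (hat c L s) = Min ?A"
    using False unfolding graph_metric_def by (simp only: if_False)
  ultimately obtain w where w: "hat c L s w \<noteq> 0" "real (graph_dist E a w) + (1 - hat c L s w) \<le> \<delta>"
    using le unfolding A by auto
  then show ?thesis using hat_support[OF c w(1)] by force
qed

text \<open>
Thinness in terms of vertices alone. The other two sides enter only through the equations that say
that \<open>v\<close> lies between their ends; this avoids any bookkeeping of directions and parametrisations.
\<close>

lemma thin_triangle:
  assumes hyp: "delta_hyperbolic (graph_points V E) (graph_metric E) \<delta>" "0 \<le> \<delta>"
    and c: "geodesic_path c L x z" and V: "x \<in> V" "y \<in> V" "z \<in> V" and i: "i \<le> L"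
  shows "\<exists>v\<in>V. real (graph_dist E (c i) v) \<le> \<delta> + 1 \<and>
    (graph_dist E x y = graph_dist E x v + graph_dist E v y \<or>
     graph_dist E z y = graph_dist E z v + graph_dist E v y)"
proof -
  obtain a where a: "geodesic_path a (graph_dist E z y) z y" using geodesic_path_exists V by blast
  obtain b where b: "geodesic_path b (graph_dist E y x) y x" using geodesic_path_exists V by blast
  let ?M = "graph_dist E z y" and ?N = "graph_dist E y x"
  let ?A = "hat a ?M ` {0..real ?M}" and ?B = "hat b ?N ` {0..real ?N}"
  have ends: "hat c L 0 = indicator {x}" "hat c L (real L) = indicator {z}"
    using hat_vertex[OF c, of 0] hat_vertex[OF c, of L] c by (simp_all add: geodesic_path_def)
  have endsa: "hat a ?M 0 = indicator {z}" "hat a ?M (real ?M) = indicator {y}"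
    using hat_vertex[OF a, of 0] hat_vertex[OF a, of ?M] a by (simp_all add: geodesic_path_def)
  have endsb: "hat b ?N 0 = indicator {y}" "hat b ?N (real ?N) = indicator {x}"
    using hat_vertex[OF b, of 0] hat_vertex[OF b, of ?N] b by (simp_all add: geodesic_path_def)
  have pts: "indicator {x} \<in> graph_points V E" "indicator {y} \<in> graph_points V E" "indicator {z} \<in> graph_points V E"
    using hat_graph_points[OF c, of 0] hat_graph_points[OF c, of "real L"] hat_graph_points[OF b, of 0]
      ends endsb by auto
  have mem: "hat c L (real i) \<in> hat c L ` {0..real L}" using i by auto
  have "\<exists>q\<in>?A \<union> ?B. graph_metric E (hat c L (real i)) q \<le> \<delta>"
    by (rule hyp(1)[unfolded delta_hyperbolic_def, rule_format, OF pts(1,3,2) _ mem])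
      (intro conjI geodesic_segment_hat[OF c, unfolded ends] geodesic_segment_hat[OF a, unfolded endsa]
        geodesic_segment_hat[OF b, unfolded endsb])
  then consider s where "s \<in> {0..real ?M}" "graph_metric E (indicator {c i}) (hat a ?M s) \<le> \<delta>"
    | s where "s \<in> {0..real ?N}" "graph_metric E (indicator {c i}) (hat b ?N s) \<le> \<delta>"
    unfolding hat_vertex[OF c i] by blast
  then show ?thesis
  proof cases
    case 1
    obtain j where j: "j \<le> ?M" "real (graph_dist E (c i) (a j)) \<le> \<delta> + 1"
      using graph_metric_vertex[OF a 1 hyp(2)] by blast
    have "a j \<in> V" "a 0 = z" "a ?M = y" using a j by (auto simp: geodesic_path_def)
    moreover have "real (graph_dist E (a 0) (a j)) = \<bar>real 0 - real j\<bar>" "real (graph_dist E (a j) (a ?M)) = \<bar>real j - real ?M\<bar>"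
      using a j unfolding geodesic_path_def by blast+
    ultimately show ?thesis using j by (intro bexI[of _ "a j"]) auto
  next
    case 2
    obtain j where j: "j \<le> ?N" "real (graph_dist E (c i) (b j)) \<le> \<delta> + 1"
      using graph_metric_vertex[OF b 2 hyp(2)] by blast
    have "b j \<in> V" "b 0 = y" "b ?N = x" using b j by (auto simp: geodesic_path_def)
    moreover have "real (graph_dist E (b 0) (b j)) = \<bar>real 0 - real j\<bar>" "real (graph_dist E (b j) (b ?N)) = \<bar>real j - real ?N\<bar>"
      using b j unfolding geodesic_path_def by blast+
    ultimately have "?N = graph_dist E y (b j) + graph_dist E (b j) x" "b j \<in> V" using j by auto
    then show ?thesis using j graph_dist_commute[of x y] graph_dist_commute[of x "b j"] graph_dist_commute[of y "b j"]
      by (intro bexI[of _ "b j"]) simp_all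
  qed
qed

text \<open>
The distance from \<open>w\<close> to a geodesic from \<open>x\<close> to \<open>z\<close> exceeds the Gromov product of \<open>x\<close> and \<open>z\<close> at \<open>w\<close>
by a bounded amount only. Every vertex of the geodesic is near the side \<open>[x, w]\<close> or near the side
\<open>[z, w]\<close>, the first one being near \<open>[x, w]\<close> and the last one near \<open>[z, w]\<close>. At the first vertex near
\<open>[z, w]\<close> the predecessor is near \<open>[x, w]\<close>, so this vertex is near both sides.
\<close>

lemma geodesic_near_point:
  assumes hyp: "delta_hyperbolic (graph_points V E) (graph_metric E) \<delta>" "0 \<le> \<delta>"
    and c: "geodesic_path c L x z" and V: "x \<in> V" "z \<in> V" "w \<in> V"
  shows "\<exists>i\<le>L. 2 * real (graph_dist E w (c i)) \<le>
    real (graph_dist E w x) + real (graph_dist E w z) - real (graph_dist E x z) + 4 * (\<delta> + 2)"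
proof -
  have ends: "c 0 = x" "c L = z" using c by (auto simp: geodesic_path_def)
  have cV: "c i \<in> V" if "i \<le> L" for i
    using c that by (auto simp: geodesic_path_def)
  define near where "near a i r \<longleftrightarrow> (\<exists>v\<in>V. real (graph_dist E (c i) v) \<le> r \<and>
      graph_dist E a w = graph_dist E a v + graph_dist E v w)" for a i r
  have mono: "near a i r'" if "near a i r" "r \<le> r'" for a i r r'
    using that unfolding near_def by (meson order_trans)
  have all: "near x i (\<delta> + 1) \<or> near z i (\<delta> + 1)" if "i \<le> L" for i
    using thin_triangle[OF hyp c V(1,3,2) that] unfolding near_def by blast
  have L: "near z L (\<delta> + 1)" unfolding near_def using V hyp ends by (intro bexI[of _ z]) auto
  define i where "i = (LEAST i. near z i (\<delta> + 1))"
  have i: "near z i (\<delta> + 1)" "i \<le> L" unfolding i_def using L by (auto intro: LeastI Least_le)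
  have "near x i (\<delta> + 2)"
  proof (cases i)
    case 0
    then show ?thesis unfolding near_def using V hyp ends by (intro bexI[of _ x]) auto
  next
    case (Suc j)
    then have "\<not> near z j (\<delta> + 1)" unfolding i_def using not_less_Least[of j] by (metis lessI)
    then obtain v where v: "v \<in> V" "real (graph_dist E (c j) v) \<le> \<delta> + 1"
      "graph_dist E x w = graph_dist E x v + graph_dist E v w"
      using all[of j] i Suc unfolding near_def by force
    have "real (graph_dist E (c i) (c j)) = 1" using c i Suc by (auto simp: geodesic_path_def)
    then have "real (graph_dist E (c i) v) \<le> \<delta> + 2"
      using graph_dist_triangle[of "c i" "c j" v] cV[of i] cV[of j] i Suc v by simp
    then show ?thesis unfolding near_def using v by blast
  qed
  then obtain v where v: "v \<in> V" "real (graph_dist E (c i) v) \<le> \<delta> + 2"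
      "graph_dist E x w = graph_dist E x v + graph_dist E v w" unfolding near_def by blast
  obtain u where u: "u \<in> V" "real (graph_dist E (c i) u) \<le> \<delta> + 2"
      "graph_dist E z w = graph_dist E z u + graph_dist E u w"
    using mono[OF i(1), of "\<delta> + 2"] unfolding near_def by auto
  note comm = graph_dist_commute
  have 1: "graph_dist E w (c i) \<le> graph_dist E w v + graph_dist E v (c i)"
    "graph_dist E w (c i) \<le> graph_dist E w u + graph_dist E u (c i)"
    "graph_dist E x (c i) \<le> graph_dist E x v + graph_dist E v (c i)"
    "graph_dist E z (c i) \<le> graph_dist E z u + graph_dist E u (c i)"
    "graph_dist E x z \<le> graph_dist E x (c i) + graph_dist E (c i) z"
    using V u v cV[OF i(2)] by (auto intro: graph_dist_triangle)
  show ?thesis using i(2) 1 u v comm[of w x] comm[of w z] comm[of w v] comm[of w u] comm[of v "c i"]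
      comm[of u "c i"] comm[of z "c i"]
    by (intro exI[of _ i]) auto
qed

text \<open>
Gromov's four-point inequality. A vertex of a geodesic from \<open>x\<close> to \<open>z\<close> that almost realises the
Gromov product at \<open>w\<close> is near some \<open>v\<close> between \<open>x\<close> and \<open>y\<close> or between \<open>z\<close> and \<open>y\<close>, and the distance from
\<open>w\<close> to such \<open>v\<close> is at least the corresponding Gromov product.
\<close>

theorem four_point:
  assumes hyp: "delta_hyperbolic (graph_points V E) (graph_metric E) \<delta>" "0 \<le> \<delta>"
    and V: "w \<in> V" "x \<in> V" "y \<in> V" "z \<in> V"
  shows "real (graph_dist E w y) + real (graph_dist E x z) \<le>
    max (real (graph_dist E w x) + real (graph_dist E y z)) (real (graph_dist E w z) + real (graph_dist E x y))
      + 6 * (\<delta> + 2)"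
proof -
  obtain c where c: "geodesic_path c (graph_dist E x z) x z" using geodesic_path_exists V by blast
  obtain i where i: "i \<le> graph_dist E x z" "2 * real (graph_dist E w (c i)) \<le>
    real (graph_dist E w x) + real (graph_dist E w z) - real (graph_dist E x z) + 4 * (\<delta> + 2)"
    using geodesic_near_point[OF hyp c V(2,4,1)] by blast
  obtain v where v: "v \<in> V" "real (graph_dist E (c i) v) \<le> \<delta> + 1"
    "graph_dist E x y = graph_dist E x v + graph_dist E v y \<or>
     graph_dist E z y = graph_dist E z v + graph_dist E v y"
    using thin_triangle[OF hyp c V(2,3,4) i(1)] by blast
  have "c i \<in> V" using c i by (auto simp: geodesic_path_def)
  then have 1: "graph_dist E w v \<le> graph_dist E w (c i) + graph_dist E (c i) v"
    "graph_dist E w y \<le> graph_dist E w v + graph_dist E v y"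
    "graph_dist E w x \<le> graph_dist E w v + graph_dist E v x"
    "graph_dist E w z \<le> graph_dist E w v + graph_dist E v z"
    using V v by (auto intro: graph_dist_triangle)
  then show ?thesis using v i(2) graph_dist_commute[of v x] graph_dist_commute[of v z] graph_dist_commute[of y z]
    by auto
qed

end

section \<open>Word length in Cayley graphs\<close>

lemma (in group) inv_mult_cancel:
  assumes "x \<in> carrier G" "y \<in> carrier G"
  shows "inv x \<otimes> (x \<otimes> y) = y" "x \<otimes> (inv x \<otimes> y) = y"
  using assms by (simp_all flip: m_assoc)

lemma (in group) commutes_inv:
  assumes "x \<in> carrier G" "y \<in> carrier G" "x \<otimes> y = y \<otimes> x"
  shows "x \<otimes> inv y = inv y \<otimes> x"
proof -
  have "x \<otimes> inv y = inv y \<otimes> (y \<otimes> x) \<otimes> inv y" using assms(1,2) by (simp add: inv_mult_cancel)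
  also have "\<dots> = inv y \<otimes> x" unfolding assms(3)[symmetric] using assms(1,2) by (simp add: m_assoc)
  finally show ?thesis .
qed

locale generated_group = group G for G (structure) +
  fixes S
  assumes generators: "S \<subseteq> carrier G" and generates: "generate G S = carrier G"
begin

lemma adjacency_mult:
  assumes "(a, b) \<in> adjacency (cayley_edges G S)" "x \<in> carrier G"
  shows "(x \<otimes> a, x \<otimes> b) \<in> adjacency (cayley_edges G S)"
proof -
  obtain g s where gs: "{a, b} = {g, g \<otimes> s}" "g \<in> carrier G" "s \<in> S" "g \<otimes> s \<noteq> g"
    using assms(1) by (auto simp: adjacency_def cayley_edges_def)
  have s: "s \<in> carrier G" using gs generators by auto
  have "a = g \<and> b = g \<otimes> s \<or> a = g \<otimes> s \<and> b = g" using gs(1) by (simp add: doubleton_eq_iff)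
  then have "{x \<otimes> a, x \<otimes> b} = {x \<otimes> g, (x \<otimes> g) \<otimes> s}" using gs s assms(2) by (auto simp: m_assoc)
  moreover have "(x \<otimes> g) \<otimes> s \<noteq> x \<otimes> g" using gs s assms(2) by (simp add: m_assoc)
  ultimately show ?thesis using gs assms(2) unfolding adjacency_def cayley_edges_def by blast
qed

lemma adjacency_carrier:
  assumes "(a, b) \<in> adjacency (cayley_edges G S)"
  shows "a \<in> carrier G" "b \<in> carrier G"
  using assms generators by (auto simp: adjacency_def cayley_edges_def doubleton_eq_iff)

lemma adjacency_step:
  assumes "(a, b) \<in> adjacency (cayley_edges G S)"
  shows "\<exists>s\<in>S. b = a \<otimes> s \<or> b = a \<otimes> inv s"
proof -
  obtain g s where gs: "{a, b} = {g, g \<otimes> s}" "g \<in> carrier G" "s \<in> S"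
    using assms by (auto simp: adjacency_def cayley_edges_def)
  have s: "s \<in> carrier G" using gs generators by auto
  have "a = g \<and> b = g \<otimes> s \<or> a = g \<otimes> s \<and> b = g" using gs(1) by (simp add: doubleton_eq_iff)
  moreover have "g \<otimes> s \<otimes> inv s = g" using gs s by (simp add: m_assoc)
  ultimately show ?thesis using gs by metis
qed

lemma adjacency_generator:
  assumes "s \<in> S" "x \<in> carrier G"
  shows "(x, x \<otimes> s) \<in> (adjacency (cayley_edges G S))\<^sup>*"
  using assms by (cases "x \<otimes> s = x") (auto simp: adjacency_def cayley_edges_def)

lemma adjacency_mult_rtrancl:
  assumes "(a, b) \<in> (adjacency (cayley_edges G S))\<^sup>*" "x \<in> carrier G"
  shows "(x \<otimes> a, x \<otimes> b) \<in> (adjacency (cayley_edges G S))\<^sup>*"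
  using assms(1) by induction (auto intro: rtrancl_into_rtrancl adjacency_mult[OF _ assms(2)])

lemma adjacency_generate:
  assumes "x \<in> generate G S"
  shows "(\<one>, x) \<in> (adjacency (cayley_edges G S))\<^sup>*"
  using assms
proof induction
  case (incl h)
  then show ?case using adjacency_generator[of h \<one>] generators by auto
next
  case (inv h)
  have h: "h \<in> carrier G" using inv generators by auto
  have "(inv h, \<one>) \<in> (adjacency (cayley_edges G S))\<^sup>*"
    using adjacency_generator[OF inv, of "inv h"] h by simp
  then show ?case by (rule symD[OF sym_rtrancl[OF sym_adjacency]])
next
  case (eng h1 h2)
  have "h1 \<in> carrier G" using eng generates by simp
  then have "(h1, h1 \<otimes> h2) \<in> (adjacency (cayley_edges G S))\<^sup>*"
    using adjacency_mult_rtrancl[OF eng.IH(2), of h1] by simp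
  then show ?case using eng.IH(1) by simp
qed simp

lemma connected_cayley_graph: "connected_graph (carrier G) (cayley_edges G S)"
proof
  fix e assume "e \<in> cayley_edges G S"
  then show "\<exists>u v. u \<in> carrier G \<and> v \<in> carrier G \<and> u \<noteq> v \<and> e = {u, v}"
    using generators unfolding cayley_edges_def by (auto 4 4)
next
  fix u v assume uv: "u \<in> carrier G" "v \<in> carrier G"
  then have "(\<one>, inv u \<otimes> v) \<in> (adjacency (cayley_edges G S))\<^sup>*"
    using adjacency_generate generates by simp
  then show "(u, v) \<in> (adjacency (cayley_edges G S))\<^sup>*"
    using adjacency_mult_rtrancl[of \<one> "inv u \<otimes> v" u] uv by (simp flip: m_assoc)
qed

sublocale connected_graph "carrier G" "cayley_edges G S"
  by (rule connected_cayley_graph)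

lemma graph_dist_mult:
  assumes "x \<in> carrier G" "a \<in> carrier G" "b \<in> carrier G"
  shows "graph_dist (cayley_edges G S) (x \<otimes> a) (x \<otimes> b) = graph_dist (cayley_edges G S) a b"
proof -
  have *: "graph_dist (cayley_edges G S) (y \<otimes> c) (y \<otimes> d) \<le> graph_dist (cayley_edges G S) c d"
    if "y \<in> carrier G" "c \<in> carrier G" "d \<in> carrier G" for y c d
  proof -
    have "(y \<otimes> c, y \<otimes> d) \<in> adjacency (cayley_edges G S) ^^ k" if "(c, d) \<in> adjacency (cayley_edges G S) ^^ k" for k
      using that
    proof (induction k arbitrary: d)
      case (Suc k)
      then show ?case using adjacency_mult[OF _ \<open>y \<in> carrier G\<close>] by auto
    qed simp
    then show ?thesis using adjacency_graph_dist that by (blast intro: graph_dist_le)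
  qed
  from *[of x a b] *[of "inv x" "x \<otimes> a" "x \<otimes> b"] assms show ?thesis
    by (simp flip: m_assoc)
qed

definition word_length :: "'a \<Rightarrow> real" where
  "word_length g = real (graph_dist (cayley_edges G S) \<one> g)"

lemma graph_dist_word_length:
  assumes "a \<in> carrier G" "b \<in> carrier G"
  shows "real (graph_dist (cayley_edges G S) a b) = word_length (inv a \<otimes> b)"
  using graph_dist_mult[of "inv a" a b] assms by (simp add: word_length_def)

lemma word_length_inv: "a \<in> carrier G \<Longrightarrow> word_length (inv a) = word_length a"
  using graph_dist_word_length[of a \<one>] graph_dist_commute[of a \<one>] by (simp add: word_length_def)

lemma word_length_mult:
  assumes "a \<in> carrier G" "b \<in> carrier G"
  shows "word_length (a \<otimes> b) \<le> word_length a + word_length b"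
  using graph_dist_triangle[of \<one> a "a \<otimes> b"] graph_dist_mult[of a \<one> b] assms by (simp add: word_length_def)

lemma word_length_conjugate:
  assumes "a \<in> carrier G" "r \<in> carrier G"
  shows "word_length (r \<otimes> a \<otimes> inv r) \<le> word_length a + 2 * word_length r"
  using word_length_mult[of "r \<otimes> a" "inv r"] word_length_mult[of r a] word_length_inv[of r] assms by simp

text \<open>
A subadditive function detects undistorted elements: it can grow along an edge of the Cayley graph
by at most its largest value at a generator or the inverse of a generator.
\<close>

lemma subadditive_le_word_length:
  fixes F :: "'a \<Rightarrow> nat"
  assumes fin: "finite S" and F1: "F \<one> = 0"
    and sub: "\<And>x y. x \<in> carrier G \<Longrightarrow> y \<in> carrier G \<Longrightarrow> F (x \<otimes> y) \<le> F x + F y"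
  shows "\<exists>K. \<forall>x\<in>carrier G. real (F x) \<le> real K * word_length x"
proof -
  define K where "K = (\<Sum>s\<in>S. F s + F (inv s))"
  have K: "F s \<le> K" "F (inv s) \<le> K" if "s \<in> S" for s
    using member_le_sum[OF that, of "\<lambda>s. F s + F (inv s)"] fin unfolding K_def by auto
  have bound: "F x \<le> K * k" if "(\<one>, x) \<in> adjacency (cayley_edges G S) ^^ k" for x k
    using that
  proof (induction k arbitrary: x)
    case 0
    then show ?case using F1 by simp
  next
    case (Suc k)
    then obtain y where y: "(\<one>, y) \<in> adjacency (cayley_edges G S) ^^ k" "(y, x) \<in> adjacency (cayley_edges G S)"
      by auto
    obtain s where s: "s \<in> S" "x = y \<otimes> s \<or> x = y \<otimes> inv s" using adjacency_step[OF y(2)] by blast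
    have "F x \<le> F y + K"
      using s sub[of y s] sub[of y "inv s"] K[OF s(1)] adjacency_carrier[OF y(2)] generators by force
    then show ?case using Suc.IH[OF y(1)] by simp
  qed
  have "real (F x) \<le> real K * word_length x" if "x \<in> carrier G" for x
  proof -
    have "F x \<le> K * graph_dist (cayley_edges G S) \<one> x"
      using bound[OF adjacency_graph_dist[of \<one> x]] that by simp
    then show ?thesis unfolding word_length_def by (metis of_nat_le_iff of_nat_mult)
  qed
  then show ?thesis by blast
qed

text \<open>
The four-point inequality for \<open>1\<close>, \<open>a\<close>, \<open>a b\<close>, \<open>b\<close>. Since \<open>a\<close> and \<open>b\<close> commute, opposite sides of this
parallelogram have equal length.
\<close>

lemma word_length_parallelogram:
  assumes hyp: "delta_hyperbolic (graph_points (carrier G) (cayley_edges G S)) (graph_metric (cayley_edges G S)) \<delta>" "0 \<le> \<delta>"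
    and ab: "a \<in> carrier G" "b \<in> carrier G" "a \<otimes> b = b \<otimes> a"
  shows "word_length (a \<otimes> b) + word_length (a \<otimes> inv b) \<le> 2 * max (word_length a) (word_length b) + 6 * (\<delta> + 2)"
proof -
  have "inv (a \<otimes> b) \<otimes> b = inv a"
    unfolding ab(3) using ab(1,2) by (simp add: inv_mult_group m_assoc)
  moreover have "inv a \<otimes> (a \<otimes> b) = b"
    using ab(1,2) by (simp add: inv_mult_cancel)
  moreover have "inv a \<otimes> b = inv (a \<otimes> inv b)"
    using commutes_inv[of b a] ab by (simp add: inv_mult_group)
  ultimately show ?thesis
    using four_point[OF hyp, of \<one> a "a \<otimes> b" b] ab graph_dist_word_length[of \<one> "a \<otimes> b"]
      graph_dist_word_length[of a b] graph_dist_word_length[of \<one> a] graph_dist_word_length[of \<one> b]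
      graph_dist_word_length[of "a \<otimes> b" b] graph_dist_word_length[of a "a \<otimes> b"]
      word_length_inv[of a] word_length_inv[of "a \<otimes> inv b"]
    by (auto simp: max_def)
qed

end

section \<open>Hexagonal lattices\<close>

lemma (in group) conjugate_pow:
  assumes "r \<in> carrier G" "g \<in> carrier G"
  shows "(r \<otimes> g \<otimes> inv r) [^] (n::nat) = r \<otimes> g [^] n \<otimes> inv r"
proof (induction n)
  case (Suc n)
  have "(r \<otimes> g [^] n \<otimes> inv r) \<otimes> (r \<otimes> g \<otimes> inv r) = r \<otimes> g [^] n \<otimes> (inv r \<otimes> r) \<otimes> g \<otimes> inv r"
    using assms by (simp add: m_assoc inv_mult_cancel)
  also have "\<dots> = r \<otimes> g [^] Suc n \<otimes> inv r" using assms by (simp add: m_assoc)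
  finally show ?case using Suc by simp
qed (use assms in simp)

text \<open>
The elements \<open>g\<close>, \<open>h = r g r\<inverse>\<close> and \<open>g h\<inverse> = r\<inverse> g r\<close> are conjugate, like three
vectors of equal length in a hexagonal lattice. Hence \<open>g\<^sup>n\<close>, \<open>h\<^sup>n\<close> and \<open>g\<^sup>n h\<^sup>-\<^sup>n\<close> have the same length up to a
bounded error. The parallelogram inequality for \<open>g\<^sup>n\<close> and \<open>h\<^sup>n\<close> makes \<open>g\<^sup>n h\<^sup>n\<close> no longer than \<open>g\<^sup>n\<close>, up to a
bounded error; applied to \<open>g\<^sup>n h\<^sup>n\<close> and \<open>g\<^sup>n h\<^sup>-\<^sup>n\<close>, whose product and quotient are \<open>g\<^sup>2\<^sup>n\<close> and \<open>h\<^sup>2\<^sup>n\<close>, it then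
makes \<open>g\<^sup>2\<^sup>n\<close> no longer than \<open>g\<^sup>n\<close>. So the length of \<open>g\<close> raised to the power \<open>2\<^sup>k\<close> grows at most linearly in \<open>k\<close>.

Commuting conjugates alone would not lead to a contradiction: parabolic isometries of a hyperbolic
space satisfy the same relations, and their displacement grows logarithmically. The function \<open>F\<close> rules
this out, as it forces the length of the powers of \<open>g\<close> to grow linearly.
\<close>

theorem (in group) hexagonal_lattice_not_hyperbolic:
  fixes F :: "'a \<Rightarrow> nat"
  assumes g: "g \<in> carrier G" and r: "r \<in> carrier G"
    and comm: "g \<otimes> (r \<otimes> g \<otimes> inv r) = (r \<otimes> g \<otimes> inv r) \<otimes> g"
    and hex: "g \<otimes> inv (r \<otimes> g \<otimes> inv r) = inv r \<otimes> g \<otimes> r"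
    and F1: "F \<one> = 0"
    and sub: "\<And>x y. x \<in> carrier G \<Longrightarrow> y \<in> carrier G \<Longrightarrow> F (x \<otimes> y) \<le> F x + F y"
    and growth: "\<And>n. n \<le> F (g [^] (n::nat))"
  shows "\<not> hyperbolic_group G"
proof
  assume "hyperbolic_group G"
  then obtain S \<delta> where S: "finite S" "S \<subseteq> carrier G" "generate G S = carrier G" and \<delta>: "0 \<le> \<delta>"
    and hyp: "delta_hyperbolic (graph_points (carrier G) (cayley_edges G S)) (graph_metric (cayley_edges G S)) \<delta>"
    unfolding hyperbolic_group_def by blast
  interpret generated_group G S by unfold_locales (use S in auto)
  define h where "h = r \<otimes> g \<otimes> inv r"
  define c where "c = 6 * (\<delta> + 2)"
  define R where "R = word_length r"
  have h: "h \<in> carrier G" using g r by (simp add: h_def)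
  have R: "0 \<le> R" by (simp add: R_def word_length_def)
  have c: "0 \<le> c" using \<delta> by (simp add: c_def)
  have doubling: "word_length (g [^] (2 * n)) \<le> word_length (g [^] n) + (8 * R + 2 * c)" for n :: nat
  proof -
    define a where "a = g [^] n"
    define b where "b = h [^] n"
    have ab: "a \<in> carrier G" "b \<in> carrier G" using g h by (auto simp: a_def b_def)
    have b_eq: "b = r \<otimes> a \<otimes> inv r" unfolding a_def b_def h_def using conjugate_pow g r by simp
    have comm_ab: "a \<otimes> b = b \<otimes> a" unfolding a_def b_def
      using g h comm group_commutes_pow[of g "h [^] n" n] group_commutes_pow[of h g n] by (simp add: h_def)
    have "g \<otimes> inv h = inv h \<otimes> g" using commutes_inv g h comm by (simp add: h_def)
    then have "(g \<otimes> inv h) [^] n = a \<otimes> inv b"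
      using pow_mult_distrib[of g "inv h" n] g h by (simp add: a_def b_def nat_pow_inv)
    moreover have "(g \<otimes> inv h) [^] n = inv r \<otimes> a \<otimes> r"
      using conjugate_pow[of "inv r" g n] g r hex by (simp add: h_def a_def)
    ultimately have ab_inv: "a \<otimes> inv b = inv r \<otimes> a \<otimes> r" by simp
    have len_b: "word_length b \<le> word_length a + 2 * R"
      unfolding b_eq R_def using word_length_conjugate ab r by simp
    have len_q: "word_length (a \<otimes> inv b) \<le> word_length a + 2 * R"
      unfolding ab_inv R_def using word_length_conjugate[of a "inv r"] word_length_inv[of r] ab r by simp
    have "a = r \<otimes> (a \<otimes> inv b) \<otimes> inv r"
      unfolding ab_inv using ab r by (simp add: m_assoc inv_mult_cancel)
    then have len_q': "word_length a \<le> word_length (a \<otimes> inv b) + 2 * R"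
      unfolding R_def using word_length_conjugate[of "a \<otimes> inv b" r] ab r by simp
    have len_p: "word_length (a \<otimes> b) \<le> word_length a + 6 * R + c"
      using word_length_parallelogram[OF hyp \<delta> ab comm_ab] len_b len_q' R
      unfolding c_def[symmetric] by (auto simp: max_def split: if_splits)
    \<comment> \<open>The second parallelogram is spanned by the diagonals of the first one.\<close>
    define p where "p = a \<otimes> b"
    define q where "q = a \<otimes> inv b"
    have pq: "p \<in> carrier G" "q \<in> carrier G" using ab by (auto simp: p_def q_def)
    have pq_eq: "p \<otimes> q = a \<otimes> a"
    proof -
      have "p \<otimes> q = a \<otimes> (b \<otimes> a) \<otimes> inv b" unfolding p_def q_def using ab by (simp add: m_assoc)
      also have "\<dots> = a \<otimes> a \<otimes> (b \<otimes> inv b)" using ab comm_ab[symmetric] by (simp add: m_assoc inv_mult_cancel)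
      finally show ?thesis using ab by simp
    qed
    have qp_eq: "q \<otimes> p = a \<otimes> a"
    proof -
      have "q \<otimes> p = a \<otimes> inv b \<otimes> (b \<otimes> a)" unfolding p_def q_def using comm_ab by simp
      also have "\<dots> = a \<otimes> (inv b \<otimes> b) \<otimes> a" using ab by (simp add: m_assoc inv_mult_cancel)
      finally show ?thesis using ab by simp
    qed
    have "p \<otimes> inv q = b \<otimes> b"
    proof -
      have "p \<otimes> inv q = (b \<otimes> a) \<otimes> (b \<otimes> inv a)"
        unfolding p_def q_def using ab comm_ab by (simp add: inv_mult_group)
      also have "\<dots> = b \<otimes> (a \<otimes> b) \<otimes> inv a" using ab by (simp add: m_assoc)
      also have "\<dots> = b \<otimes> b \<otimes> (a \<otimes> inv a)" unfolding comm_ab using ab by (simp add: m_assoc inv_mult_cancel)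
      finally show ?thesis using ab by simp
    qed
    then have par: "word_length (a \<otimes> a) + word_length (b \<otimes> b) \<le> 2 * max (word_length p) (word_length q) + c"
      using word_length_parallelogram[OF hyp \<delta> pq] pq_eq qp_eq unfolding c_def by simp
    have "b \<otimes> b = r \<otimes> (a \<otimes> a) \<otimes> inv r"
    proof -
      have "b \<otimes> b = r \<otimes> a \<otimes> (inv r \<otimes> r) \<otimes> a \<otimes> inv r" unfolding b_eq using ab r by (simp add: m_assoc inv_mult_cancel)
      then show ?thesis using ab r by (simp add: m_assoc)
    qed
    then have "a \<otimes> a = inv r \<otimes> (b \<otimes> b) \<otimes> r" using ab r by (simp add: m_assoc inv_mult_cancel)
    then have "word_length (a \<otimes> a) \<le> word_length (b \<otimes> b) + 2 * R"
      unfolding R_def using word_length_conjugate[of "b \<otimes> b" "inv r"] word_length_inv[of r] ab r by simp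
    moreover have "a \<otimes> a = g [^] (2 * n)" unfolding a_def using g by (simp add: nat_pow_mult mult_2)
    ultimately show ?thesis using par len_p len_q R c unfolding p_def q_def a_def[symmetric]
      by (auto simp: max_def split: if_splits)
  qed
  define C where "C = 8 * R + 2 * c"
  have linear: "word_length (g [^] ((2::nat) ^ k)) \<le> word_length g + real k * C" for k
  proof (induction k)
    case 0
    then show ?case using g by simp
  next
    case (Suc k)
    then show ?case using doubling[of "2 ^ k"] by (simp add: C_def algebra_simps)
  qed
  obtain K where K: "\<And>x. x \<in> carrier G \<Longrightarrow> real (F x) \<le> real K * word_length x"
    using subadditive_le_word_length[OF S(1) F1 sub] by blast
  have le: "2 ^ k \<le> real K * (word_length g + real k * C)" for k
  proof -
    have "real (2 ^ k) \<le> real (F (g [^] ((2::nat) ^ k)))" using growth[of "2 ^ k"] by (simp del: of_nat_power)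
    also have "\<dots> \<le> real K * word_length (g [^] ((2::nat) ^ k))" using K g by simp
    also have "\<dots> \<le> real K * (word_length g + real k * C)" using linear by (intro mult_left_mono) auto
    finally show ?thesis by simp
  qed
  have "((\<lambda>k. (real K * (word_length g + real k * C)) / 2 ^ k) \<longlongrightarrow> 0) sequentially"
    by real_asymp
  then have "\<forall>\<^sub>F k in sequentially. (real K * (word_length g + real k * C)) / 2 ^ k < 1"
    by (rule order_tendstoD) simp
  then obtain k where "(real K * (word_length g + real k * C)) / 2 ^ k < 1"
    by (auto simp: eventually_sequentially)
  then show False using le[of k] by (simp add: field_simps)
qed

text \<open>
The relations are those of the rotations of the plane by \<open>2 \<pi> / 6\<close> and \<open>2 \<pi> / 3\<close> about two corners
of a Euclidean triangle; the product \<open>a b\<close> is the half turn about the third corner. The angles of \<open>a\<^sup>2\<close> and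
\<open>b\<close> agree, so \<open>g = a\<^sup>2 b\<inverse>\<close> is a translation, and conjugation by \<open>a\<close> turns it by \<open>2 \<pi> / 6\<close>. The two
conclusions express that these vectors form a hexagonal lattice, and they follow from the three relations alone.

Write \<open>g\<^sub>i = a\<^sup>i g a\<^sup>-\<^sup>i\<close>. The first conclusion is \<open>g\<^sub>0 = g\<^sub>-\<^sub>1 g\<^sub>1\<close>, and conjugating it by \<open>a\<close> gives
\<open>g\<^sub>1 = g\<^sub>0 g\<^sub>2\<close> and \<open>g\<^sub>2 = g\<^sub>1 g\<^sub>3\<close>. Together with \<open>g\<^sub>3 = g\<^sub>0\<inverse>\<close> this yields \<open>g\<^sub>1 = g\<^sub>0 g\<^sub>1 g\<^sub>0\<inverse>\<close>, which is the
second conclusion.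
\<close>

lemma (in group) triangle_group_hexagonal:
  assumes a: "a \<in> carrier G" and b: "b \<in> carrier G"
    and a6: "a \<otimes> (a \<otimes> (a \<otimes> (a \<otimes> (a \<otimes> a)))) = \<one>" and b3: "b \<otimes> (b \<otimes> b) = \<one>"
    and ab2: "a \<otimes> (b \<otimes> (a \<otimes> b)) = \<one>"
  defines "g \<equiv> a \<otimes> a \<otimes> inv b"
  shows "g \<otimes> inv (a \<otimes> g \<otimes> inv a) = inv a \<otimes> g \<otimes> a"
    and "g \<otimes> (a \<otimes> g \<otimes> inv a) = (a \<otimes> g \<otimes> inv a) \<otimes> g"
proof -
  let ?P = "inv a" and ?q = "inv b"
  have c[simp]: "x \<in> carrier G \<Longrightarrow> ?P \<otimes> (a \<otimes> x) = x" "x \<in> carrier G \<Longrightarrow> a \<otimes> (?P \<otimes> x) = x"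
    "x \<in> carrier G \<Longrightarrow> ?q \<otimes> (b \<otimes> x) = x" "x \<in> carrier G \<Longrightarrow> b \<otimes> (?q \<otimes> x) = x" for x
    using a b by (simp_all flip: m_assoc)
  have P5: "a = ?P \<otimes> (?P \<otimes> (?P \<otimes> (?P \<otimes> ?P)))"
  proof -
    have "?P \<otimes> (?P \<otimes> (?P \<otimes> (?P \<otimes> (?P \<otimes> (a \<otimes> (a \<otimes> (a \<otimes> (a \<otimes> (a \<otimes> a))))))))) = ?P \<otimes> (?P \<otimes> (?P \<otimes> (?P \<otimes> (?P \<otimes> \<one>))))"
      using a6 by simp
    then show ?thesis using a by simp
  qed
  have P3: "a \<otimes> (a \<otimes> a) = ?P \<otimes> (?P \<otimes> ?P)"
  proof -
    have "a \<otimes> (a \<otimes> a) = a \<otimes> (a \<otimes> (?P \<otimes> (?P \<otimes> (?P \<otimes> (?P \<otimes> ?P)))))" using P5 by simp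
    then show ?thesis using a by simp
  qed
  have P3': "a \<otimes> (a \<otimes> (a \<otimes> x)) = ?P \<otimes> (?P \<otimes> (?P \<otimes> x))" if "x \<in> carrier G" for x
    using P3 a that by (metis inv_closed m_assoc m_closed)
  have qq: "?q \<otimes> ?q = b"
  proof -
    have "?q \<otimes> (?q \<otimes> (b \<otimes> (b \<otimes> b))) = ?q \<otimes> (?q \<otimes> \<one>)" using b3 by simp
    then show ?thesis using b by simp
  qed
  have qq': "?q \<otimes> (?q \<otimes> x) = b \<otimes> x" if "x \<in> carrier G" for x
    using qq b that by (metis inv_closed m_assoc)
  have ab: "a \<otimes> b = ?q \<otimes> ?P"
  proof -
    have "(a \<otimes> b) \<otimes> (a \<otimes> b) = \<one>" using ab2 a b by (simp add: m_assoc)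
    then have "inv (a \<otimes> b) = a \<otimes> b" using a b by (intro inv_equality) auto
    then show ?thesis using a b by (simp add: inv_mult_group)
  qed
  have ab': "a \<otimes> (b \<otimes> x) = ?q \<otimes> (?P \<otimes> x)" if "x \<in> carrier G" for x
    using ab a b that by (metis inv_closed m_assoc)
  have Pq: "?P \<otimes> ?q = b \<otimes> a"
  proof -
    have "b \<otimes> (a \<otimes> b) = ?P" using ab a b by simp
    then have "b \<otimes> (a \<otimes> b) \<otimes> ?q = ?P \<otimes> ?q" by simp
    then show ?thesis using a b by (simp add: m_assoc)
  qed
  have Pq': "?P \<otimes> (?q \<otimes> x) = b \<otimes> (a \<otimes> x)" if "x \<in> carrier G" for x
    using Pq a b that by (metis inv_closed m_assoc)
  have g: "g \<in> carrier G" and g_eq: "g = a \<otimes> (a \<otimes> ?q)" using a b by (simp_all add: g_def m_assoc)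
  have inv_g: "inv g = b \<otimes> (?P \<otimes> ?P)" using a b by (simp add: g_def inv_mult_group m_assoc)
  have hex: "g \<otimes> inv (a \<otimes> g \<otimes> ?P) = ?P \<otimes> g \<otimes> a"
  proof -
    have "inv (a \<otimes> g \<otimes> ?P) = a \<otimes> (b \<otimes> (?P \<otimes> (?P \<otimes> ?P)))"
      using a b g by (simp add: inv_mult_group inv_g m_assoc)
    also have "\<dots> = ?q \<otimes> (?P \<otimes> (?P \<otimes> (?P \<otimes> ?P)))" using a b by (simp add: ab')
    finally have "g \<otimes> inv (a \<otimes> g \<otimes> ?P) = a \<otimes> (a \<otimes> (?q \<otimes> (?q \<otimes> (?P \<otimes> (?P \<otimes> (?P \<otimes> ?P))))))"
      unfolding g_eq using a b by (simp add: m_assoc)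
    also have "\<dots> = a \<otimes> (?q \<otimes> (?P \<otimes> (?P \<otimes> (?P \<otimes> (?P \<otimes> ?P)))))" using a b by (simp add: qq' ab')
    also have "\<dots> = a \<otimes> (?q \<otimes> a)" using P5 by simp
    also have "\<dots> = ?P \<otimes> g \<otimes> a" unfolding g_eq using a b by (simp add: m_assoc)
    finally show ?thesis .
  qed
  then show "g \<otimes> inv (a \<otimes> g \<otimes> inv a) = inv a \<otimes> g \<otimes> a" .
  have half_turn: "a \<otimes> (a \<otimes> (a \<otimes> (g \<otimes> (?P \<otimes> (?P \<otimes> ?P))))) = inv g"
  proof -
    have "a \<otimes> (a \<otimes> (a \<otimes> (g \<otimes> (?P \<otimes> (?P \<otimes> ?P))))) = ?P \<otimes> (?q \<otimes> (?P \<otimes> (?P \<otimes> ?P)))"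
      unfolding inv_g using a b g by (simp add: P3') (simp add: g_eq m_assoc)
    also have "\<dots> = inv g" unfolding inv_g using a b by (simp add: Pq')
    finally show ?thesis .
  qed
  define h where "h = a \<otimes> g \<otimes> ?P"
  define k where "k = a \<otimes> h \<otimes> ?P"
  have h: "h \<in> carrier G" and k: "k \<in> carrier G" using a g by (simp_all add: h_def k_def)
  have g_eq2: "g = ?P \<otimes> g \<otimes> a \<otimes> h"
    using hex a g h unfolding h_def[symmetric] by (metis inv_closed inv_solve_right m_closed)
  have conj: "a \<otimes> (x \<otimes> y) \<otimes> ?P = (a \<otimes> x \<otimes> ?P) \<otimes> (a \<otimes> y \<otimes> ?P)" if "x \<in> carrier G" "y \<in> carrier G" for x y
    using a that by (simp add: m_assoc)
  have "h = a \<otimes> (?P \<otimes> g \<otimes> a \<otimes> h) \<otimes> ?P" using g_eq2 by (simp add: h_def)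
  also have "\<dots> = g \<otimes> k" using a g h unfolding k_def by (simp add: m_assoc)
  finally have h_eq: "h = g \<otimes> k" .
  then have "k = h \<otimes> (a \<otimes> k \<otimes> ?P)" using conj[OF g k] by (simp add: k_def h_def)
  moreover have "a \<otimes> k \<otimes> ?P = inv g"
    using half_turn a g unfolding k_def h_def by (simp add: m_assoc)
  ultimately have "h = g \<otimes> (h \<otimes> inv g)" using h_eq by simp
  then have "h \<otimes> g = g \<otimes> h \<otimes> (inv g \<otimes> g)" using g h by (metis inv_closed m_assoc m_closed)
  then show "g \<otimes> (a \<otimes> g \<otimes> ?P) = (a \<otimes> g \<otimes> ?P) \<otimes> g" using g h by (simp add: h_def)
qed

section \<open>Words and separating walls\<close>

text \<open>
The exponents of the letters are ignored, since the generators will act as involutions.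
\<close>

fun word_action :: "('v \<Rightarrow> 'e \<Rightarrow> 'e) \<Rightarrow> ('v \<times> bool) list \<Rightarrow> 'e \<Rightarrow> 'e" where
  "word_action \<sigma> [] = id"
| "word_action \<sigma> (l # w) = \<sigma> (fst l) \<circ> word_action \<sigma> w"

text \<open>
For a word \<open>s\<^sub>1 \<dots> s\<^sub>k\<close> this collects the conjugates of \<open>s\<^sub>i\<close> by the prefixes \<open>s\<^sub>1 \<dots> s\<^sub>i\<^sub>-\<^sub>1\<close>: the
reflections in the walls that the gallery described by the word crosses.
\<close>

fun reflections :: "('v \<Rightarrow> 'e \<Rightarrow> 'e) \<Rightarrow> ('v \<times> bool) list \<Rightarrow> ('e \<Rightarrow> 'e) multiset" where
  "reflections \<sigma> [] = {#}"
| "reflections \<sigma> (l # w) = add_mset (\<sigma> (fst l)) (image_mset (\<lambda>\<tau>. \<sigma> (fst l) \<circ> \<tau> \<circ> \<sigma> (fst l)) (reflections \<sigma> w))"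

text \<open>
A wall separates the ends of a gallery if the gallery crosses it an odd number of times. The parity,
unlike the number of crossings, depends only on the group element that the word represents.
\<close>

definition inversions :: "('v \<Rightarrow> 'e \<Rightarrow> 'e) \<Rightarrow> ('v \<times> bool) list \<Rightarrow> ('e \<Rightarrow> 'e) set" where
  "inversions \<sigma> w = {\<tau>. odd (count (reflections \<sigma> w) \<tau>)}"

lemma word_action_append: "word_action \<sigma> (u @ w) = word_action \<sigma> u \<circ> word_action \<sigma> w"
  by (induction u) (auto simp: comp_assoc)

lemma reflections_append:
  "reflections \<sigma> (u @ w) =
    reflections \<sigma> u + image_mset (\<lambda>\<tau>. word_action \<sigma> u \<circ> \<tau> \<circ> word_action \<sigma> (rev u)) (reflections \<sigma> w)"
  by (induction u) (auto simp: word_action_append comp_def multiset.map_comp)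

lemma odd_count_image_mset:
  assumes "odd (count (image_mset f M) y)"
  shows "\<exists>x. odd (count M x) \<and> f x = y"
proof -
  have "count (image_mset f M) y = (\<Sum>x\<in>f -` {y} \<inter> set_mset M. count M x)" by (rule count_image_mset)
  then have "\<exists>x\<in>f -` {y} \<inter> set_mset M. odd (count M x)" using assms by (metis dvd_sum)
  then show ?thesis by auto
qed

lemma finite_inversions: "finite (inversions \<sigma> w)"
  unfolding inversions_def
  by (rule finite_subset[of _ "set_mset (reflections \<sigma> w)"]) (auto intro: odd_pos simp flip: count_greater_zero_iff)

lemma card_inversions_append: "card (inversions \<sigma> (u @ w)) \<le> card (inversions \<sigma> u) + card (inversions \<sigma> w)"
proof -
  let ?f = "\<lambda>\<tau>. word_action \<sigma> u \<circ> \<tau> \<circ> word_action \<sigma> (rev u)"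
  have "inversions \<sigma> (u @ w) \<subseteq> inversions \<sigma> u \<union> ?f ` inversions \<sigma> w"
  proof
    fix \<tau> assume "\<tau> \<in> inversions \<sigma> (u @ w)"
    then have "odd (count (reflections \<sigma> u) \<tau>) \<or> odd (count (image_mset ?f (reflections \<sigma> w)) \<tau>)"
      by (simp add: inversions_def reflections_append)
    then show "\<tau> \<in> inversions \<sigma> u \<union> ?f ` inversions \<sigma> w"
    proof
      assume "odd (count (image_mset ?f (reflections \<sigma> w)) \<tau>)"
      from odd_count_image_mset[OF this] show ?thesis unfolding inversions_def by blast
    qed (simp add: inversions_def)
  qed
  then have "card (inversions \<sigma> (u @ w)) \<le> card (inversions \<sigma> u \<union> ?f ` inversions \<sigma> w)"
    by (intro card_mono) (simp_all add: finite_inversions)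
  also have "\<dots> \<le> card (inversions \<sigma> u) + card (?f ` inversions \<sigma> w)" by (rule card_Un_le)
  also have "\<dots> \<le> card (inversions \<sigma> u) + card (inversions \<sigma> w)"
    using card_image_le[OF finite_inversions] by simp
  finally show ?thesis .
qed

locale coxeter_action =
  fixes V :: "'v set" and \<Gamma> :: "'v set \<Rightarrow> nat option" and \<sigma> :: "'v \<Rightarrow> 'e \<Rightarrow> 'e"
  assumes involution: "v \<in> V \<Longrightarrow> \<sigma> v \<circ> \<sigma> v = id"
    and dihedral: "u \<in> V \<Longrightarrow> v \<in> V \<Longrightarrow> u \<noteq> v \<Longrightarrow> \<Gamma> {u, v} = Some m \<Longrightarrow> (\<sigma> u \<circ> \<sigma> v) ^^ m = id"
begin

lemma word_action_alternating: "word_action \<sigma> (concat (replicate m [(u, True), (v, True)])) = (\<sigma> u \<circ> \<sigma> v) ^^ m"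
  by (induction m) (auto simp: comp_assoc)

text \<open>
The reflections of a dihedral group in cyclic order, run through twice if \<open>m\<close> is the order of
\<open>\<sigma> u \<circ> \<sigma> v\<close>.
\<close>

lemma reflections_alternating:
  "reflections \<sigma> (concat (replicate m [(u, True), (v, True)])) = mset (map (\<lambda>i. (\<sigma> u \<circ> \<sigma> v) ^^ i \<circ> \<sigma> u) [0..<2 * m])"
proof (induction m)
  case (Suc m)
  let ?f = "\<lambda>i. (\<sigma> u \<circ> \<sigma> v) ^^ i \<circ> \<sigma> u"
  have shift: "\<sigma> u \<circ> (\<sigma> v \<circ> ?f i \<circ> \<sigma> v) \<circ> \<sigma> u = ?f (i + 2)" for i
  proof -
    have "(\<sigma> u \<circ> \<sigma> v) ^^ (i + 2) = (\<sigma> u \<circ> \<sigma> v) \<circ> (\<sigma> u \<circ> \<sigma> v) ^^ Suc i" by simp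
    also have "(\<sigma> u \<circ> \<sigma> v) ^^ Suc i = (\<sigma> u \<circ> \<sigma> v) ^^ i \<circ> (\<sigma> u \<circ> \<sigma> v)"
      by (rule funpow_Suc_right)
    finally show ?thesis by (simp only: comp_assoc)
  qed
  have "[0..<2 * Suc m] = 0 # 1 # map (\<lambda>i. i + 2) [0..<2 * m]"
    using map_add_upt[of 2 "2 * m"] by (simp add: upt_conv_Cons numeral_2_eq_2 del: upt_Suc)
  then have "mset (map ?f [0..<2 * Suc m]) = add_mset (?f 0) (add_mset (?f 1) (mset (map (\<lambda>i. ?f (i + 2)) [0..<2 * m])))"
    by (simp add: comp_def del: upt_Suc)
  also have "\<dots> = reflections \<sigma> (concat (replicate (Suc m) [(u, True), (v, True)]))"
    using shift by (simp add: Suc multiset.map_comp comp_def flip: mset_map)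
  finally show ?case by (simp only:)
qed simp

text \<open>
A relator crosses every wall an even number of times. For a dihedral relator this is the periodicity
of the list in the preceding lemma.
\<close>

lemma relator_doubled:
  assumes "r \<in> coxeter_relators V \<Gamma>"
  shows "word_action \<sigma> r = id" and "\<exists>M. reflections \<sigma> r = M + M"
proof -
  consider v where "v \<in> V" "r = [(v, True), (v, True)]"
    | u v m where "u \<in> V" "v \<in> V" "u \<noteq> v" "\<Gamma> {u, v} = Some m" "r = concat (replicate m [(u, True), (v, True)])"
    using assms unfolding coxeter_relators_def by blast
  then have "word_action \<sigma> r = id \<and> (\<exists>M. reflections \<sigma> r = M + M)"
  proof cases
    case 1
    have "reflections \<sigma> r = {#\<sigma> v#} + {#\<sigma> v#}" "word_action \<sigma> r = id"
      using 1(2) involution[OF 1(1)] by (simp_all add: comp_assoc)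
    then show ?thesis by blast
  next
    case 2
    define F where "F i = (\<sigma> u \<circ> \<sigma> v) ^^ i \<circ> \<sigma> u" for i
    have id: "(\<sigma> u \<circ> \<sigma> v) ^^ m = id" using dihedral 2 by simp
    have "F (i + m) = F i" for i unfolding F_def by (simp only: funpow_add id comp_id)
    then have period: "map F (map (\<lambda>i. i + m) [0..<m]) = map F [0..<m]" by simp
    have "[0..<2 * m] = [0..<m] @ map (\<lambda>i. i + m) [0..<m]"
      using upt_add_eq_append[of 0 m m] by (simp add: mult_2 map_add_upt)
    then have "reflections \<sigma> r = mset (map F [0..<m]) + mset (map F [0..<m])"
      unfolding 2(5) reflections_alternating F_def[symmetric] by (simp only: map_append mset_append period)
    moreover have "word_action \<sigma> r = id" unfolding 2(5) word_action_alternating by (rule id)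
    ultimately show ?thesis by blast
  qed
  then show "word_action \<sigma> r = id" "\<exists>M. reflections \<sigma> r = M + M" by auto
qed

lemma inversions_insert:
  assumes "word_action \<sigma> r = id" "word_action \<sigma> (rev r) = id" "reflections \<sigma> r = M + M"
  shows "inversions \<sigma> (u @ r @ w) = inversions \<sigma> (u @ w)"
  unfolding inversions_def using assms by (simp add: reflections_append word_action_append)

lemma word_action_rev:
  assumes "w \<in> gen_words V"
  shows "word_action \<sigma> w \<circ> word_action \<sigma> (rev w) = id" and "word_action \<sigma> (rev w) \<circ> word_action \<sigma> w = id"
proof -
  have "word_action \<sigma> w \<circ> word_action \<sigma> (rev w) = id \<and> word_action \<sigma> (rev w) \<circ> word_action \<sigma> w = id"
    using assms
  proof (induction w)
    case (Cons l w)
    let ?s = "\<sigma> (fst l)" and ?w = "word_action \<sigma> w" and ?r = "word_action \<sigma> (rev w)"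
    have l: "fst l \<in> V" and "w \<in> gen_words V" using Cons.prems by (auto simp: gen_words_def)
    then have w: "?w \<circ> ?r = id" "?r \<circ> ?w = id" using Cons.IH by blast+
    have s: "?s \<circ> ?s = id" using involution[OF l] .
    have "?s \<circ> ?w \<circ> (?r \<circ> ?s) = ?s \<circ> (?w \<circ> ?r) \<circ> ?s" by (simp add: comp_assoc)
    moreover have "?r \<circ> ?s \<circ> (?s \<circ> ?w) = ?r \<circ> (?s \<circ> ?s) \<circ> ?w" by (simp only: comp_assoc)
    ultimately show ?case
      by (simp only: rev.simps word_action_append word_action.simps s w comp_id id_comp simp_thms)
  qed simp
  then show "word_action \<sigma> w \<circ> word_action \<sigma> (rev w) = id" "word_action \<sigma> (rev w) \<circ> word_action \<sigma> w = id" by auto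
qed

lemma inversions_pres_rel:
  assumes "(u, w) \<in> pres_rel V (coxeter_relators V \<Gamma>)"
  shows "inversions \<sigma> u = inversions \<sigma> w"
  using assms
proof induction
  case (cancel u w x b)
  have "\<sigma> x \<circ> \<sigma> x = id" using involution cancel by simp
  then show ?case using inversions_insert[of "[(x, b), (x, \<not> b)]" "{#\<sigma> x#}" u w] by (simp add: comp_assoc)
next
  case (relator u w r)
  have "word_action \<sigma> (rev r) = id"
    using word_action_rev(2)[of r] relator_doubled(1)[of r] relator by simp
  moreover obtain M where "reflections \<sigma> r = M + M" using relator_doubled(2) relator by blast
  ultimately show ?case using inversions_insert[of r M u w] relator_doubled(1)[of r] relator by simp
qed auto

text \<open>
All words in a class have the same inversions, so the choice of the word does not matter.
\<close>

definition inversion_number :: "('v \<times> bool) list set \<Rightarrow> nat" where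
  "inversion_number x = card (inversions \<sigma> (SOME w. w \<in> x))"

lemma inversion_number_class:
  assumes "w \<in> gen_words V"
  shows "inversion_number (pres_rel V (coxeter_relators V \<Gamma>) `` {w}) = card (inversions \<sigma> w)"
proof -
  let ?x = "pres_rel V (coxeter_relators V \<Gamma>) `` {w}"
  have "w \<in> ?x" using assms by (auto intro: pres_rel.refl)
  then have "(SOME w. w \<in> ?x) \<in> ?x" by (rule someI)
  then show ?thesis unfolding inversion_number_def using inversions_pres_rel by fastforce
qed

lemma inversion_number_one: "inversion_number \<one>\<^bsub>coxeter_group V \<Gamma>\<^esub> = 0"
  using inversion_number_class[of "[]"]
  by (simp add: coxeter_group_def presented_group_def gen_words_def inversions_def)

lemma inversion_number_mult:
  assumes "x \<in> carrier (coxeter_group V \<Gamma>)" "y \<in> carrier (coxeter_group V \<Gamma>)"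
  shows "inversion_number (x \<otimes>\<^bsub>coxeter_group V \<Gamma>\<^esub> y) \<le> inversion_number x + inversion_number y"
proof -
  obtain u w where uw: "u \<in> gen_words V" "x = pres_rel V (coxeter_relators V \<Gamma>) `` {u}"
    "w \<in> gen_words V" "y = pres_rel V (coxeter_relators V \<Gamma>) `` {w}"
    using assms by (auto simp: coxeter_group_def presented_group_def quotient_def)
  have "u @ w \<in> gen_words V" using uw by (auto simp: gen_words_def)
  then show ?thesis using uw card_inversions_append[of \<sigma> u w]
    by (simp add: coxeter_group_def presented_group_mult inversion_number_class)
qed

end

lemma word_action_power: "word_action \<sigma> (concat (replicate n w)) = word_action \<sigma> w ^^ n"
  by (induction n) (auto simp: word_action_append)

lemma reflections_power:
  "reflections \<sigma> (concat (replicate n w)) =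
    (\<Sum>l<n. image_mset (\<lambda>\<tau>. (word_action \<sigma> w ^^ l) \<circ> \<tau> \<circ> (word_action \<sigma> (rev w) ^^ l)) (reflections \<sigma> w))"
proof (induction n)
  case (Suc n)
  have "concat (replicate (Suc n) w) = concat (replicate n w) @ w"
    by (simp flip: replicate_append_same)
  moreover have "rev (concat (replicate n w)) = concat (replicate n (rev w))"
    by (simp add: rev_concat)
  ultimately show ?case by (simp add: Suc reflections_append word_action_power comp_def)
qed simp

text \<open>
A lower bound for the length of powers: if the wall \<open>\<tau>\<^sub>0\<close> is crossed once by \<open>w\<close>, its images under the
powers of \<open>w\<close> are all different, and these images are met by no image of another wall that \<open>w\<close> crosses, then
the power with exponent \<open>n\<close> crosses \<open>n\<close> different walls exactly once.
\<close>

lemma card_inversions_power: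
  fixes \<sigma> w
  defines "twist \<equiv> \<lambda>l \<tau>. (word_action \<sigma> w ^^ l) \<circ> \<tau> \<circ> (word_action \<sigma> (rev w) ^^ l)"
  assumes w: "reflections \<sigma> w = add_mset \<tau>\<^sub>0 M"
    and other: "\<And>\<tau> k l. \<tau> \<in># M \<Longrightarrow> twist l \<tau> \<noteq> twist k \<tau>\<^sub>0"
    and inj: "inj (\<lambda>k. twist k \<tau>\<^sub>0)"
  shows "n \<le> card (inversions \<sigma> (concat (replicate n w)))"
proof -
  have "count (reflections \<sigma> (concat (replicate n w))) (twist k \<tau>\<^sub>0) = 1" if "k < n" for k
  proof -
    have "count (image_mset (twist l) M) (twist k \<tau>\<^sub>0) = 0" for l
    proof -
      have "twist k \<tau>\<^sub>0 \<notin> twist l ` set_mset M"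
      proof
        assume "twist k \<tau>\<^sub>0 \<in> twist l ` set_mset M"
        then obtain \<tau> where "\<tau> \<in># M" "twist k \<tau>\<^sub>0 = twist l \<tau>" by blast
        then show False using other[of \<tau> l k] by simp
      qed
      then show ?thesis by (simp add: count_eq_zero_iff)
    qed
    then have "count (image_mset (twist l) (reflections \<sigma> w)) (twist k \<tau>\<^sub>0) = (if l = k then 1 else 0)" for l
      using injD[OF inj, of l k] by (auto simp: w)
    moreover have "reflections \<sigma> (concat (replicate n w)) = (\<Sum>l<n. image_mset (twist l) (reflections \<sigma> w))"
      unfolding twist_def by (rule reflections_power)
    ultimately show ?thesis using that by (simp add: count_sum)
  qed
  then have sub: "(\<lambda>k. twist k \<tau>\<^sub>0) ` {..<n} \<subseteq> inversions \<sigma> (concat (replicate n w))"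
    by (auto simp: inversions_def)
  have "n = card ((\<lambda>k. twist k \<tau>\<^sub>0) ` {..<n})"
    using inj by (simp add: card_image inj_on_subset)
  also have "\<dots> \<le> card (inversions \<sigma> (concat (replicate n w)))"
    using sub by (rule card_mono[OF finite_inversions])
  finally show ?thesis .
qed

section \<open>The Tits representation\<close>

text \<open>
The bilinear form of the Tits representation on the space with one basis vector for each vertex. The
reflections that it defines satisfy the relations of the whole Coxeter group, and the span of some of the basis vectors is invariant under the
corresponding generators, so that computations with a few generators separate elements of the whole group.
\<close>

definition tits_form :: "('v set \<Rightarrow> nat option) \<Rightarrow> 'v \<Rightarrow> 'v \<Rightarrow> real" where
  "tits_form \<Gamma> i j = (if i = j then 1 else case \<Gamma> {i, j} of Some m \<Rightarrow> - cos (pi / m) | None \<Rightarrow> - 1)"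

definition tits_pairing :: "'v set \<Rightarrow> ('v set \<Rightarrow> nat option) \<Rightarrow> 'v \<Rightarrow> ('v \<Rightarrow> real) \<Rightarrow> real" where
  "tits_pairing V \<Gamma> i x = (\<Sum>j\<in>V. tits_form \<Gamma> i j * x j)"

definition tits_reflection :: "'v set \<Rightarrow> ('v set \<Rightarrow> nat option) \<Rightarrow> 'v \<Rightarrow> ('v \<Rightarrow> real) \<Rightarrow> 'v \<Rightarrow> real" where
  "tits_reflection V \<Gamma> i x = x(i := x i - 2 * tits_pairing V \<Gamma> i x)"

lemma tits_pairing_update:
  assumes "finite V" "k \<in> V"
  shows "tits_pairing V \<Gamma> i (x(k := x k - c)) = tits_pairing V \<Gamma> i x - tits_form \<Gamma> i k * c"
proof -
  have "tits_pairing V \<Gamma> i (x(k := x k - c)) = (\<Sum>j\<in>V. tits_form \<Gamma> i j * x j - (if j = k then tits_form \<Gamma> i k * c else 0))"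
    unfolding tits_pairing_def by (rule sum.cong) (auto simp: algebra_simps)
  then show ?thesis using assms by (simp add: sum_subtractf tits_pairing_def)
qed

lemma tits_pairing_reflection:
  assumes "finite V" "k \<in> V"
  shows "tits_pairing V \<Gamma> i (tits_reflection V \<Gamma> k x) =
    tits_pairing V \<Gamma> i x - 2 * tits_form \<Gamma> i k * tits_pairing V \<Gamma> k x"
  unfolding tits_reflection_def using tits_pairing_update[OF assms] by simp

lemma tits_reflection_involution:
  assumes "finite V" "k \<in> V"
  shows "tits_reflection V \<Gamma> k \<circ> tits_reflection V \<Gamma> k = id"
proof
  fix x
  have "tits_pairing V \<Gamma> k (tits_reflection V \<Gamma> k x) = - tits_pairing V \<Gamma> k x"
    using tits_pairing_reflection[OF assms] by (simp add: tits_form_def)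
  then show "(tits_reflection V \<Gamma> k \<circ> tits_reflection V \<Gamma> k) x = id x"
    unfolding comp_def by (subst tits_reflection_def) (simp add: tits_reflection_def)
qed

text \<open>
Encode the values of the form at \<open>u\<close> and \<open>v\<close> in the complex number \<open>z\<close>. The two reflections act on
\<open>z\<close> as complex conjugation and as conjugation followed by a rotation, so that their product acts as the rotation by
\<open>2 \<pi> / m\<close>, and its power with exponent \<open>m\<close> fixes \<open>z\<close>. This power changes vectors only in the directions \<open>u\<close>
and \<open>v\<close>, and the form is nondegenerate on the plane that they span.
\<close>

lemma tits_dihedral:
  assumes V: "finite V" "u \<in> V" "v \<in> V" "u \<noteq> v" and m: "\<Gamma> {u, v} = Some m" "2 \<le> m"
  shows "(tits_reflection V \<Gamma> u \<circ> tits_reflection V \<Gamma> v) ^^ m = id"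
proof
  fix x
  define \<theta> where "\<theta> = pi / m"
  define T where "T = tits_reflection V \<Gamma> u \<circ> tits_reflection V \<Gamma> v"
  have form: "tits_form \<Gamma> u v = - cos \<theta>" "tits_form \<Gamma> v u = - cos \<theta>" "tits_form \<Gamma> u u = 1" "tits_form \<Gamma> v v = 1"
    using V(4) m(1) by (auto simp: tits_form_def \<theta>_def insert_commute)
  have "0 < \<theta>" "\<theta> < pi" using m(2) by (auto simp: \<theta>_def field_simps)
  then have sin: "0 < sin \<theta>" by (rule sin_gt_zero)
  define B where "B = tits_pairing V \<Gamma>"
  define z where "z x = complex_of_real (B u x) + complex_of_real (B v x) * cis \<theta>" for x
  have zv: "z (tits_reflection V \<Gamma> v x) = cnj (z x)" for x
    unfolding z_def B_def using V by (simp add: tits_pairing_reflection form complex_eq_iff algebra_simps)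
  have zu: "z (tits_reflection V \<Gamma> u x) = cis (2 * \<theta>) * cnj (z x)" for x
  proof -
    have "z (tits_reflection V \<Gamma> u x) =
        - complex_of_real (B u x) + (complex_of_real (B v x) + 2 * complex_of_real (cos \<theta>) * complex_of_real (B u x)) * cis \<theta>"
      unfolding z_def B_def using V by (simp add: tits_pairing_reflection form)
    also have "\<dots> = complex_of_real (B u x) * (2 * complex_of_real (cos \<theta>) * cis \<theta> - 1) + complex_of_real (B v x) * cis \<theta>"
      by (simp add: algebra_simps)
    also have "2 * complex_of_real (cos \<theta>) * cis \<theta> - 1 = cis (2 * \<theta>)"
      by (simp add: complex_eq_iff cos_double_cos sin_double power2_eq_square)
    also have "cis \<theta> = cis (2 * \<theta>) * cis (- \<theta>)" by (simp add: cis_mult)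
    finally show ?thesis by (simp add: z_def cis_cnj algebra_simps)
  qed
  have zT: "z ((T ^^ k) x) = cis (2 * \<theta> * k) * z x" for k
  proof (induction k)
    case (Suc k)
    have "z ((T ^^ Suc k) x) = cis (2 * \<theta>) * z ((T ^^ k) x)" by (simp add: T_def zu zv)
    then show ?case using Suc by (simp add: cis_mult algebra_simps)
  qed simp
  have out: "(T ^^ k) x i = x i" if "i \<noteq> u" "i \<noteq> v" for k i
    by (induction k) (use that in \<open>auto simp: T_def tits_reflection_def\<close>)
  define y where "y = (T ^^ m) x"
  have "2 * \<theta> * m = 2 * pi" using m(2) by (simp add: \<theta>_def)
  then have "cis (2 * \<theta> * m) = 1" by (simp only: cis_2pi)
  then have zy: "z y = z x" using zT[of m] by (simp add: y_def)
  have "B v y * sin \<theta> = B v x * sin \<theta>" using arg_cong[OF zy, of Im] by (simp add: z_def)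
  then have Bv: "B v y = B v x" using sin by simp
  then have Bu: "B u y = B u x" using arg_cong[OF zy, of Re] by (simp add: z_def)
  define a where "a = x u - y u"
  define b where "b = x v - y v"
  have y: "y = (x(u := x u - a))(v := (x(u := x u - a)) v - b)"
    using out[of _ m] V(4) by (auto simp: fun_eq_iff y_def a_def b_def)
  have Bi: "B i y = B i x - tits_form \<Gamma> i u * a - tits_form \<Gamma> i v * b" for i
    unfolding y B_def using V by (simp only: tits_pairing_update)
  have "a = cos \<theta> * b" "b = cos \<theta> * a" using Bi[of u] Bi[of v] Bu Bv form by (auto simp: algebra_simps)
  then have "a * (1 - cos \<theta> * cos \<theta>) = 0" "b * (1 - cos \<theta> * cos \<theta>) = 0" by (auto simp: algebra_simps)
  moreover have "1 - cos \<theta> * cos \<theta> = sin \<theta> * sin \<theta>" using sin_cos_squared_add[of \<theta>] by (simp add: power2_eq_square)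
  ultimately have "a = 0" "b = 0" using sin by auto
  then show "((tits_reflection V \<Gamma> u \<circ> tits_reflection V \<Gamma> v) ^^ m) x = id x"
    using y unfolding T_def[symmetric] y_def[symmetric] by (auto simp: fun_eq_iff)
qed

lemma coxeter_action_tits:
  assumes "finite V" "\<And>u v m. u \<in> V \<Longrightarrow> v \<in> V \<Longrightarrow> u \<noteq> v \<Longrightarrow> \<Gamma> {u, v} = Some m \<Longrightarrow> 2 \<le> m"
  shows "coxeter_action V \<Gamma> (tits_reflection V \<Gamma>)"
  using assms by unfold_locales (auto intro: tits_reflection_involution tits_dihedral)

section \<open>Euclidean triangles in Coxeter graphs\<close>

definition coxeter_element :: "'v set \<Rightarrow> ('v set \<Rightarrow> nat option) \<Rightarrow> ('v \<times> bool) list \<Rightarrow> ('v \<times> bool) list set" where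
  "coxeter_element V \<Gamma> w = pres_rel V (coxeter_relators V \<Gamma>) `` {w}"

lemma group_coxeter_group: "group (coxeter_group V \<Gamma>)"
  unfolding coxeter_group_def by (rule group_presented_group)

lemma coxeter_element_carrier: "w \<in> gen_words V \<Longrightarrow> coxeter_element V \<Gamma> w \<in> carrier (coxeter_group V \<Gamma>)"
  by (simp add: coxeter_element_def coxeter_group_def presented_group_def quotientI)

lemma coxeter_element_Nil: "coxeter_element V \<Gamma> [] = \<one>\<^bsub>coxeter_group V \<Gamma>\<^esub>"
  by (simp add: coxeter_element_def coxeter_group_def presented_group_def)

lemma coxeter_element_append:
  assumes "u \<in> gen_words V" "w \<in> gen_words V"
  shows "coxeter_element V \<Gamma> (u @ w) = coxeter_element V \<Gamma> u \<otimes>\<^bsub>coxeter_group V \<Gamma>\<^esub> coxeter_element V \<Gamma> w"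
  using assms by (simp add: coxeter_element_def coxeter_group_def presented_group_mult)

lemma coxeter_element_relator:
  assumes "r \<in> coxeter_relators V \<Gamma>" "r \<in> gen_words V"
  shows "coxeter_element V \<Gamma> r = \<one>\<^bsub>coxeter_group V \<Gamma>\<^esub>"
proof -
  have "([] @ r @ [], [] @ []) \<in> pres_rel V (coxeter_relators V \<Gamma>)"
    using assms by (intro pres_rel.relator) (auto simp: gen_words_def)
  then show ?thesis unfolding coxeter_element_Nil[symmetric] coxeter_element_def
    by (intro equiv_class_eq[OF equiv_pres_rel]) simp
qed

lemma concat_replicate_gen_words: "w \<in> gen_words V \<Longrightarrow> concat (replicate n w) \<in> gen_words V"
  by (induction n) (auto simp: gen_words_def)

lemma coxeter_element_power:
  assumes "w \<in> gen_words V"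
  shows "coxeter_element V \<Gamma> (concat (replicate n w)) = coxeter_element V \<Gamma> w [^]\<^bsub>coxeter_group V \<Gamma>\<^esub> n"
proof (induction n)
  case (Suc n)
  have "concat (replicate (Suc n) w) = concat (replicate n w) @ w"
    by (simp flip: replicate_append_same)
  moreover have "concat (replicate n w) \<in> gen_words V" using assms by (rule concat_replicate_gen_words)
  ultimately show ?case using Suc assms by (simp add: coxeter_element_append)
qed (simp add: coxeter_element_Nil)

text \<open>
The angles \<open>\<pi> / 2\<close>, \<open>\<pi> / 3\<close> and \<open>\<pi> / 6\<close> add up to \<open>\<pi>\<close>: the three generators act as the reflections
in the sides of a Euclidean triangle.
\<close>

locale euclidean_triangle =
  fixes V :: "'v set" and \<Gamma> :: "'v set \<Rightarrow> nat option" and s t u :: 'v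
  assumes finite_vertices: "finite V"
    and labels: "\<And>x y m. x \<in> V \<Longrightarrow> y \<in> V \<Longrightarrow> x \<noteq> y \<Longrightarrow> \<Gamma> {x, y} = Some m \<Longrightarrow> 2 \<le> m"
    and corners: "s \<in> V" "t \<in> V" "u \<in> V" "s \<noteq> t" "t \<noteq> u" "s \<noteq> u"
    and sides: "\<Gamma> {s, t} = Some 6" "\<Gamma> {t, u} = Some 3" "\<Gamma> {s, u} = Some 2"
begin

abbreviation "\<sigma> \<equiv> tits_reflection V \<Gamma>"

sublocale coxeter_action V \<Gamma> \<sigma>
  using finite_vertices labels by (rule coxeter_action_tits)

text \<open>
The three basis vectors at the corners span an invariant subspace. The scaling by \<open>sqrt 3\<close> makes the
reflections integral. The vector \<open>(3, 2, 1)\<close> spans the radical of the form, and it is fixed by all three reflections.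
\<close>

definition span_vector :: "real \<Rightarrow> real \<Rightarrow> real \<Rightarrow> 'v \<Rightarrow> real" where
  "span_vector a b c = (\<lambda>_. 0)(s := a / sqrt 3, t := b, u := c)"

lemma span_vector_eq: "span_vector a b c = span_vector a' b' c' \<longleftrightarrow> a = a' \<and> b = b' \<and> c = c'"
proof
  assume eq: "span_vector a b c = span_vector a' b' c'"
  show "a = a' \<and> b = b' \<and> c = c'"
    using fun_cong[OF eq, of s] fun_cong[OF eq, of t] fun_cong[OF eq, of u] corners
    by (simp add: span_vector_def)
qed simp

lemma tits_pairing_span_vector:
  "tits_pairing V \<Gamma> i (span_vector a b c) = tits_form \<Gamma> i s * (a / sqrt 3) + tits_form \<Gamma> i t * b + tits_form \<Gamma> i u * c"
proof -
  have "tits_pairing V \<Gamma> i (span_vector a b c) = (\<Sum>j\<in>{s, t, u}. tits_form \<Gamma> i j * span_vector a b c j)"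
    unfolding tits_pairing_def using corners finite_vertices
    by (intro sum.mono_neutral_right) (auto simp: span_vector_def)
  then show ?thesis using corners by (simp add: span_vector_def)
qed

lemma form_values:
  "tits_form \<Gamma> s s = 1" "tits_form \<Gamma> t t = 1" "tits_form \<Gamma> u u = 1"
  "tits_form \<Gamma> s t = - (sqrt 3 / 2)" "tits_form \<Gamma> t s = - (sqrt 3 / 2)"
  "tits_form \<Gamma> t u = - (1 / 2)" "tits_form \<Gamma> u t = - (1 / 2)"
  "tits_form \<Gamma> s u = 0" "tits_form \<Gamma> u s = 0"
  using corners sides by (simp_all add: tits_form_def insert_commute cos_30 cos_60)

lemma reflection_span_vector:
  "\<sigma> s (span_vector a b c) = span_vector (- a + 3 * b) b c"
  "\<sigma> t (span_vector a b c) = span_vector a (a - b + c) c"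
  "\<sigma> u (span_vector a b c) = span_vector a b (b - c)"
proof -
  have scale: "(3 * b - a) / sqrt 3 = sqrt 3 * b - a / sqrt 3"
  proof -
    have "3 * b / sqrt 3 = 3 / sqrt 3 * b" by simp
    also have "3 / sqrt 3 = sqrt 3" by (rule real_div_sqrt) simp
    finally show ?thesis by (simp only: diff_divide_distrib)
  qed
  show "\<sigma> s (span_vector a b c) = span_vector (- a + 3 * b) b c"
    unfolding tits_reflection_def tits_pairing_span_vector form_values using corners
    by (auto simp: span_vector_def fun_eq_iff scale)
  show "\<sigma> t (span_vector a b c) = span_vector a (a - b + c) c"
    "\<sigma> u (span_vector a b c) = span_vector a b (b - c)"
    unfolding tits_reflection_def tits_pairing_span_vector form_values using corners
    by (auto simp: span_vector_def fun_eq_iff)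
qed

text \<open>
The translation \<open>a\<^sup>2 b\<inverse>\<close> for the rotations \<open>a = s t\<close> and \<open>b = t u\<close>.
\<close>

definition translation_word :: "('v \<times> bool) list" where
  "translation_word = [(s, True), (t, True), (s, True), (t, True), (u, True), (t, True)]"

text \<open>
Translations act on the span by adding multiples of the radical vector \<open>(3, 2, 1)\<close>.
\<close>

lemma translation_power:
  "(word_action \<sigma> translation_word ^^ l) (span_vector a b c) =
    span_vector (a + 3 * l * (a - b - c)) (b + 2 * l * (a - b - c)) (c + l * (a - b - c))"
  by (induction l) (simp_all add: translation_word_def reflection_span_vector span_vector_eq algebra_simps)

lemma translation_power_inverse:
  "(word_action \<sigma> (rev translation_word) ^^ l) (span_vector a b c) =
    span_vector (a - 3 * l * (a - b - c)) (b - 2 * l * (a - b - c)) (c - l * (a - b - c))"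
  by (induction l) (simp_all add: translation_word_def reflection_span_vector span_vector_eq algebra_simps)

text \<open>
Among the six walls that the translation word crosses, the wall of \<open>s\<close> has a direction of its own.
All reflections involved are told apart by their values at the vector \<open>(0, 1, 0)\<close>: modulo the radical, the
value separates the translates of the wall of \<open>s\<close> from those of the other walls, and the coefficient of
\<open>(3, 2, 1)\<close> separates the translates of the wall of \<open>s\<close> from one another.
\<close>

lemma translation_length: "n \<le> card (inversions \<sigma> (concat (replicate n translation_word)))"
proof -
  let ?twist = "\<lambda>l \<tau>. (word_action \<sigma> translation_word ^^ l) \<circ> \<tau> \<circ> (word_action \<sigma> (rev translation_word) ^^ l)"
  let ?x = "span_vector 0 1 0"
  define M where "M = mset (map (\<lambda>w. word_action \<sigma> (map (\<lambda>v. (v, True)) w))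
    [[s, t, s], [s, t, s, t, s], [s, t, s, t, s, t, s], [s, t, s, t, u, t, s, t, s],
     [s, t, s, t, u, t, u, t, s, t, s]])"
  have refl: "reflections \<sigma> translation_word = add_mset (\<sigma> s) M"
    unfolding M_def translation_word_def by (simp add: comp_assoc)
  have x0: "?twist k (\<sigma> s) ?x = span_vector (3 + 9 * k) (1 + 6 * k) (3 * k)" for k
    by (simp add: translation_power translation_power_inverse reflection_span_vector span_vector_eq algebra_simps)
  have x: "?twist l \<tau> ?x \<in> {span_vector (3 + 6 * l) (2 + 4 * l) (2 * l), span_vector 0 1 0,
      span_vector (- 3 - 3 * l) (- 1 - 2 * l) (- real l), span_vector (6 + 6 * l) (4 + 4 * l) (1 + 2 * l),
      span_vector (6 + 6 * l) (3 + 4 * l) (2 + 2 * l)}" if "\<tau> \<in># M" for \<tau> l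
    using that unfolding M_def
    by (auto simp: translation_power translation_power_inverse reflection_span_vector span_vector_eq algebra_simps)
  show ?thesis
  proof (rule card_inversions_power[OF refl])
    fix \<tau> k l assume \<tau>: "\<tau> \<in># M"
    show "?twist l \<tau> \<noteq> ?twist k (\<sigma> s)"
    proof
      assume "?twist l \<tau> = ?twist k (\<sigma> s)"
      then have "?twist l \<tau> ?x = span_vector (3 + 9 * k) (1 + 6 * k) (3 * k)" using x0 by metis
      then show False using x[OF \<tau>, of l] by (auto simp: span_vector_eq)
    qed
  next
    show "inj (\<lambda>k. ?twist k (\<sigma> s))"
    proof (rule injI)
      fix k l assume "?twist k (\<sigma> s) = ?twist l (\<sigma> s)"
      then show "k = l" using x0[of k] x0[of l] by (simp add: span_vector_eq)
    qed
  qed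
qed

text \<open>
The translation and its conjugate by the rotation \<open>s t\<close> span a hexagonal lattice, and the number of
separating walls is the subadditive function that certifies that the lattice is undistorted in the whole Coxeter group.
\<close>

theorem not_hyperbolic: "\<not> hyperbolic_group (coxeter_group V \<Gamma>)"
proof -
  let ?G = "coxeter_group V \<Gamma>"
  interpret group ?G by (rule group_coxeter_group)
  define e where "e w = coxeter_element V \<Gamma> (map (\<lambda>v. (v, True)) w)" for w
  have words: "map (\<lambda>v. (v, True)) w \<in> gen_words V \<longleftrightarrow> set w \<subseteq> V" for w
    by (auto simp: gen_words_def)
  have e_carrier: "e w \<in> carrier ?G" if "set w \<subseteq> V" for w
    using coxeter_element_carrier words that unfolding e_def by blast
  have app: "e (v @ w) = e v \<otimes>\<^bsub>?G\<^esub> e w" if "set v \<subseteq> V" "set w \<subseteq> V" for v w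
    using coxeter_element_append words that unfolding e_def by (metis map_append)
  have square: "e [x, x] = \<one>\<^bsub>?G\<^esub>" if "x \<in> V" for x
    unfolding e_def using that words[of "[x, x]"]
    by (intro coxeter_element_relator) (auto simp: coxeter_relators_def)
  have rel: "e (concat (replicate m [x, y])) = \<one>\<^bsub>?G\<^esub>"
    if "x \<in> V" "y \<in> V" "x \<noteq> y" "\<Gamma> {x, y} = Some m" for x y m
  proof -
    have "map (\<lambda>v. (v, True)) (concat (replicate m [x, y])) = concat (replicate m [(x, True), (y, True)])"
      by (simp add: map_concat)
    moreover have "concat (replicate m [(x, True), (y, True)]) \<in> gen_words V"
      using that by (intro concat_replicate_gen_words) (simp add: gen_words_def)
    moreover have "concat (replicate m [(x, True), (y, True)]) \<in> coxeter_relators V \<Gamma>"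
      using that by (auto simp: coxeter_relators_def)
    ultimately show ?thesis unfolding e_def by (simp add: coxeter_element_relator)
  qed
  have cancel: "e (v @ [x, x] @ w) = e (v @ w)" if "x \<in> V" "set v \<subseteq> V" "set w \<subseteq> V" for v w x
    using that app[of v "[x, x] @ w"] app[of "[x, x]" w] app[of v w] e_carrier[of v] e_carrier[of w] square[of x]
    by simp
  define a where "a = e [s, t]"
  define b where "b = e [t, u]"
  have ab: "a \<in> carrier ?G" "b \<in> carrier ?G" using corners by (simp_all add: a_def b_def e_carrier)
  have inv_b: "inv\<^bsub>?G\<^esub> b = e [u, t]"
  proof (rule inv_equality)
    have "e [u, t] \<otimes>\<^bsub>?G\<^esub> b = e ([u] @ [t, t] @ [u])"
      unfolding b_def using corners by (simp flip: app)
    also have "\<dots> = \<one>\<^bsub>?G\<^esub>" using corners square cancel[of t "[u]" "[u]"] by simp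
    finally show "e [u, t] \<otimes>\<^bsub>?G\<^esub> b = \<one>\<^bsub>?G\<^esub>" .
  qed (use ab corners e_carrier in auto)
  have a6: "a \<otimes>\<^bsub>?G\<^esub> (a \<otimes>\<^bsub>?G\<^esub> (a \<otimes>\<^bsub>?G\<^esub> (a \<otimes>\<^bsub>?G\<^esub> (a \<otimes>\<^bsub>?G\<^esub> a)))) = \<one>\<^bsub>?G\<^esub>"
    using rel[of s t 6] corners sides unfolding a_def by (simp add: eval_nat_numeral flip: app)
  have b3: "b \<otimes>\<^bsub>?G\<^esub> (b \<otimes>\<^bsub>?G\<^esub> b) = \<one>\<^bsub>?G\<^esub>"
    using rel[of t u 3] corners sides unfolding b_def by (simp add: eval_nat_numeral flip: app)
  have "a \<otimes>\<^bsub>?G\<^esub> b = e [s, u]"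
    using cancel[of t "[s]" "[u]"] corners unfolding a_def b_def by (simp flip: app)
  then have "(a \<otimes>\<^bsub>?G\<^esub> b) \<otimes>\<^bsub>?G\<^esub> (a \<otimes>\<^bsub>?G\<^esub> b) = \<one>\<^bsub>?G\<^esub>"
    using rel[of s u 2] corners sides by (simp add: eval_nat_numeral flip: app)
  then have ab2: "a \<otimes>\<^bsub>?G\<^esub> (b \<otimes>\<^bsub>?G\<^esub> (a \<otimes>\<^bsub>?G\<^esub> b)) = \<one>\<^bsub>?G\<^esub>" using ab by (simp add: m_assoc)
  define g where "g = a \<otimes>\<^bsub>?G\<^esub> a \<otimes>\<^bsub>?G\<^esub> inv\<^bsub>?G\<^esub> b"
  have g: "g \<in> carrier ?G" using ab by (simp add: g_def)
  have W: "translation_word = map (\<lambda>v. (v, True)) [s, t, s, t, u, t]" by (simp add: translation_word_def)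
  have Wg: "translation_word \<in> gen_words V" unfolding W words using corners by simp
  have g_word: "g = coxeter_element V \<Gamma> translation_word"
    unfolding g_def inv_b a_def W e_def[symmetric] using corners by (simp flip: app)
  have "n \<le> inversion_number (g [^]\<^bsub>?G\<^esub> n)" for n :: nat
  proof -
    have "concat (replicate n translation_word) \<in> gen_words V"
      using Wg by (rule concat_replicate_gen_words)
    then have "inversion_number (g [^]\<^bsub>?G\<^esub> n) = card (inversions \<sigma> (concat (replicate n translation_word)))"
      unfolding g_word coxeter_element_power[OF Wg, symmetric]
      by (simp add: coxeter_element_def inversion_number_class)
    then show ?thesis using translation_length by simp
  qed
  with g ab(1) triangle_group_hexagonal(2)[OF ab a6 b3 ab2] triangle_group_hexagonal(1)[OF ab a6 b3 ab2]
    inversion_number_one inversion_number_mult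
  show ?thesis unfolding g_def[symmetric] by (rule hexagonal_lattice_not_hyperbolic)
qed

end

section \<open>Labelled triangles in random graphs\<close>

text \<open>
The second moment method: Chebyshev's inequality for the number of events that occur.
\<close>

lemma prob_no_event_le:
  fixes \<mu> :: "'a pmf" and A :: "'i \<Rightarrow> 'a set"
  assumes I: "finite I" and m: "m = (\<Sum>t\<in>I. measure_pmf.prob \<mu> (A t))" "0 < m"
    and v: "(\<Sum>t\<in>I. \<Sum>t'\<in>I. measure_pmf.prob \<mu> (A t \<inter> A t')) \<le> m\<^sup>2 * (1 + \<eta>)"
  shows "measure_pmf.prob \<mu> {x. \<forall>t\<in>I. x \<notin> A t} \<le> \<eta>"
proof -
  define X where "X x = (\<Sum>t\<in>I. indicator (A t) x :: real)" for x
  have bound: "\<bar>X x\<bar> \<le> card I" for x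
  proof -
    have "0 \<le> X x" by (simp add: X_def sum_nonneg)
    moreover have "X x \<le> (\<Sum>t\<in>I. 1)" unfolding X_def by (intro sum_mono) (simp add: indicator_def)
    ultimately show ?thesis by simp
  qed
  have intX: "integrable (measure_pmf \<mu>) X"
    by (rule measure_pmf.integrable_const_bound[where B = "card I"]) (use bound in auto)
  have intX2: "integrable (measure_pmf \<mu>) (\<lambda>x. (X x)\<^sup>2)"
  proof (rule measure_pmf.integrable_const_bound[where B = "(card I)\<^sup>2"])
    show "AE x in measure_pmf \<mu>. norm ((X x)\<^sup>2) \<le> real ((card I)\<^sup>2)"
      using power_mono[OF bound, where n = 2] by (intro always_eventually allI) simp
  qed auto
  have int_ind: "integrable (measure_pmf \<mu>) (indicator B :: 'a \<Rightarrow> real)" for B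
    by (auto intro: measure_pmf.integrable_const_bound[where B = 1])
  have EX: "measure_pmf.expectation \<mu> X = m"
    unfolding X_def m(1) by (subst Bochner_Integration.integral_sum) (auto intro: int_ind)
  have "(X x)\<^sup>2 = (\<Sum>t\<in>I. \<Sum>t'\<in>I. indicator (A t \<inter> A t') x)" for x
    unfolding X_def power2_eq_square sum_product by (simp add: indicator_inter_arith)
  then have "measure_pmf.expectation \<mu> (\<lambda>x. (X x)\<^sup>2) = (\<Sum>t\<in>I. \<Sum>t'\<in>I. measure_pmf.prob \<mu> (A t \<inter> A t'))"
    by (simp add: Bochner_Integration.integral_sum integrable_sum int_ind)
  then have var: "measure_pmf.variance \<mu> X \<le> m\<^sup>2 * \<eta>"
    using v measure_pmf.variance_eq[OF intX intX2] EX by (simp add: algebra_simps)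
  have "measure_pmf.prob \<mu> {x. \<forall>t\<in>I. x \<notin> A t} \<le> measure_pmf.prob \<mu> {x\<in>space (measure_pmf \<mu>). \<bar>X x - m\<bar> \<ge> m}"
    by (rule measure_pmf.finite_measure_mono) (use m(2) in \<open>auto simp: X_def\<close>)
  also have "\<dots> \<le> measure_pmf.variance \<mu> X / m\<^sup>2"
    using measure_pmf.Chebyshev_inequality[OF _ intX2 m(2)] EX by simp
  also have "\<dots> \<le> \<eta>" using var m(2) by (simp add: field_simps)
  finally show ?thesis .
qed

definition vertex_pairs :: "nat \<Rightarrow> nat set set" where
  "vertex_pairs n = {e. e \<subseteq> {..<n} \<and> card e = 2}"

lemma finite_vertex_pairs: "finite (vertex_pairs n)"
  unfolding vertex_pairs_def by (rule finite_subset[of _ "Pow {..<n}"]) auto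

lemma prob_random_graph_labels:
  assumes "label_probabilities q" "K \<subseteq> vertex_pairs n" "\<And>e. e \<in> K \<Longrightarrow> 2 \<le> f e"
  shows "measure_pmf.prob (random_graph n q) {\<Gamma>. \<forall>e\<in>K. \<Gamma> e = Some (f e)} = (\<Prod>e\<in>K. q (f e))"
proof -
  let ?B = "\<lambda>e. if e \<in> K then {Some (f e)} else UNIV"
  have "{\<Gamma>. \<forall>e\<in>K. \<Gamma> e = Some (f e)} = Pi (vertex_pairs n) ?B"
    using assms(2) by (auto simp: Pi_def)
  then have "measure_pmf.prob (random_graph n q) {\<Gamma>. \<forall>e\<in>K. \<Gamma> e = Some (f e)} =
      (\<Prod>e\<in>vertex_pairs n. measure_pmf.prob (label_pmf q) (?B e))"
    unfolding random_graph_def vertex_pairs_def[symmetric]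
    by (simp add: measure_Pi_pmf_Pi finite_vertex_pairs)
  also have "\<dots> = (\<Prod>e\<in>K. measure_pmf.prob (label_pmf q) (?B e))"
    using assms(2) by (intro prod.mono_neutral_right finite_vertex_pairs) auto
  also have "\<dots> = (\<Prod>e\<in>K. q (f e))"
  proof (rule prod.cong[OF HOL.refl])
    fix e assume "e \<in> K"
    then show "measure_pmf.prob (label_pmf q) (?B e) = q (f e)"
      using assms(1) assms(3)[of e] by (simp add: measure_pmf_single pmf_label_pmf)
  qed
  finally show ?thesis .
qed

lemma random_graph_labels_ge_2:
  assumes "label_probabilities q" "\<Gamma> \<in> set_pmf (random_graph n q)" "x < n" "y < n" "x \<noteq> y" "\<Gamma> {x, y} = Some m"
  shows "2 \<le> m"
proof -
  have "\<Gamma> \<in> PiE_dflt (vertex_pairs n) None (set_pmf \<circ> (\<lambda>_. label_pmf q))"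
    using assms(2) unfolding random_graph_def vertex_pairs_def[symmetric] set_Pi_pmf[OF finite_vertex_pairs] .
  moreover have "{x, y} \<in> vertex_pairs n" using assms by (simp add: vertex_pairs_def)
  ultimately have "Some m \<in> set_pmf (label_pmf q)" using assms(6) unfolding PiE_dflt_def by force
  then have "pmf (label_pmf q) (Some m) \<noteq> 0" by (simp add: set_pmf_eq)
  then show ?thesis using assms(1) by (simp add: pmf_label_pmf split: if_splits)
qed

text \<open>
Only triangles with one corner in each of three disjoint blocks of \<open>k\<close> vertices are counted. Then the
required label of an edge depends only on the two blocks of its ends, and the events of two triangles are
always compatible.
\<close>

definition triangle_edges :: "nat \<Rightarrow> nat \<times> nat \<times> nat \<Rightarrow> nat set set" where
  "triangle_edges k = (\<lambda>(i, j, l). {{i, k + j}, {k + j, 2 * k + l}, {i, 2 * k + l}})"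

text \<open>
The edges between the first two blocks are those with maximum below \<open>2 k\<close>; among the others, an edge
with an end in the first block leads to the third block.
\<close>

definition triangle_label :: "nat \<Rightarrow> nat set \<Rightarrow> nat" where
  "triangle_label k e = (if Max e < 2 * k then 6 else if Min e < k then 2 else 3)"

lemma triangle_label_values:
  assumes "i < k" "j < k" "l < k"
  shows "triangle_label k {i, k + j} = 6" "triangle_label k {k + j, 2 * k + l} = 3" "triangle_label k {i, 2 * k + l} = 2"
  using assms by (auto simp: triangle_label_def)

lemma prod_triangle_edges:
  fixes h :: "nat set \<Rightarrow> real"
  assumes "i < k" "j < k" "l < k"
  shows "(\<Prod>e\<in>triangle_edges k (i, j, l). h e) = h {i, k + j} * h {k + j, 2 * k + l} * h {i, 2 * k + l}"
proof -
  have "{i, k + j} \<noteq> {k + j, 2 * k + l}" "{i, k + j} \<noteq> {i, 2 * k + l}" "{k + j, 2 * k + l} \<noteq> {i, 2 * k + l}"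
    using assms by (auto simp: doubleton_eq_iff)
  then show ?thesis unfolding triangle_edges_def by (simp add: mult.assoc)
qed

lemma shared_triangle_edges:
  assumes "i < k" "j < k" "l < k" "i' < k" "j' < k" "l' < k"
  shows "{i, k + j} \<in> triangle_edges k (i', j', l') \<longleftrightarrow> i' = i \<and> j' = j"
    and "{k + j, 2 * k + l} \<in> triangle_edges k (i', j', l') \<longleftrightarrow> j' = j \<and> l' = l"
    and "{i, 2 * k + l} \<in> triangle_edges k (i', j', l') \<longleftrightarrow> i' = i \<and> l' = l"
  using assms by (auto simp: triangle_edges_def doubleton_eq_iff)

text \<open>
Each shared edge is required only once, so that the factor for its label has to be divided out of the
product of the two probabilities.
\<close>

lemma prob_two_triangles:
  fixes q :: "nat \<Rightarrow> real"
  defines "E \<equiv> \<lambda>k t. {\<Gamma>. \<forall>e\<in>triangle_edges k t. \<Gamma> e = Some (triangle_label k e)}"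
  assumes q: "label_probabilities q" and pos: "0 < q 2" "0 < q 3" "0 < q 6" and k: "3 * k \<le> n"
    and t: "i < k" "j < k" "l < k" and t': "i' < k" "j' < k" "l' < k"
  shows "measure_pmf.prob (random_graph n q) (E k (i, j, l)) = q 6 * q 3 * q 2"
    and "measure_pmf.prob (random_graph n q) (E k (i, j, l) \<inter> E k (i', j', l')) =
      (q 6 * q 3 * q 2)\<^sup>2 * ((if i' = i \<and> j' = j then 1 / q 6 else 1) *
        (if j' = j \<and> l' = l then 1 / q 3 else 1) * (if i' = i \<and> l' = l then 1 / q 2 else 1))"
proof -
  let ?T = "triangle_edges k (i, j, l)" and ?T' = "triangle_edges k (i', j', l')"
  let ?h = "\<lambda>e. q (triangle_label k e)"
  have sub: "triangle_edges k (a, b, c) \<subseteq> vertex_pairs n" if "a < k" "b < k" "c < k" for a b c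
    using that k by (auto simp: triangle_edges_def vertex_pairs_def card_insert_if)
  have ge: "2 \<le> triangle_label k e" for e by (simp add: triangle_label_def)
  have single: "(\<Prod>e\<in>triangle_edges k (a, b, c). ?h e) = q 6 * q 3 * q 2" if "a < k" "b < k" "c < k" for a b c
    using that by (simp add: prod_triangle_edges triangle_label_values)
  show "measure_pmf.prob (random_graph n q) (E k (i, j, l)) = q 6 * q 3 * q 2"
    unfolding E_def using prob_random_graph_labels[OF q sub[OF t] ge] single[OF t] by simp
  have fin: "finite ?T" "finite ?T'" by (simp_all add: triangle_edges_def)
  have "E k (i, j, l) \<inter> E k (i', j', l') = {\<Gamma>. \<forall>e\<in>?T \<union> ?T'. \<Gamma> e = Some (triangle_label k e)}"
    by (auto simp: E_def)
  then have "measure_pmf.prob (random_graph n q) (E k (i, j, l) \<inter> E k (i', j', l')) = (\<Prod>e\<in>?T \<union> ?T'. ?h e)"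
    using prob_random_graph_labels[OF q, of "?T \<union> ?T'" n "triangle_label k"] sub[OF t] sub[OF t'] ge by simp
  also have "\<dots> = (\<Prod>e\<in>?T. ?h e) * (\<Prod>e\<in>?T' - ?T. ?h e)"
    using prod.union_disjoint[of ?T "?T' - ?T" ?h] fin by simp
  also have "(\<Prod>e\<in>?T' - ?T. ?h e) = (\<Prod>e\<in>?T'. ?h e * (if e \<in> ?T then 1 / ?h e else 1))"
  proof -
    have "(\<Prod>e\<in>?T' - ?T. ?h e) = (\<Prod>e\<in>?T'. if e \<in> ?T then 1 else ?h e)"
      using fin by (intro prod.mono_neutral_cong_left) auto
    also have "\<dots> = (\<Prod>e\<in>?T'. ?h e * (if e \<in> ?T then 1 / ?h e else 1))"
      using pos by (intro prod.cong) (auto simp: triangle_label_def)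
    finally show ?thesis .
  qed
  also have "\<dots> = (q 6 * q 3 * q 2) * ((if i' = i \<and> j' = j then 1 / q 6 else 1) *
        (if j' = j \<and> l' = l then 1 / q 3 else 1) * (if i' = i \<and> l' = l then 1 / q 2 else 1))"
    unfolding prod_triangle_edges[OF t'] shared_triangle_edges[OF t' t]
    using t' by (auto simp: triangle_label_values)
  finally show "measure_pmf.prob (random_graph n q) (E k (i, j, l) \<inter> E k (i', j', l')) =
      (q 6 * q 3 * q 2)\<^sup>2 * ((if i' = i \<and> j' = j then 1 / q 6 else 1) *
        (if j' = j \<and> l' = l then 1 / q 3 else 1) * (if i' = i \<and> l' = l then 1 / q 2 else 1))"
    unfolding single[OF t] by (simp add: power2_eq_square)
qed

text \<open>
Triangles that agree in two corners share one edge; if they share two edges they are equal.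
Expanding the product, a single factor different from 1 leaves \<open>k\<close> choices for the remaining corner, and two or three leave
none.
\<close>

lemma overlap_sum_le:
  fixes x y z :: real
  assumes "0 \<le> x" "0 \<le> y" "0 \<le> z" and t: "i < k" "j < k" "l < k"
  shows "(\<Sum>(i', j', l')\<in>{..<k} \<times> {..<k} \<times> {..<k}. (if i' = i \<and> j' = j then x else 1) *
      (if j' = j \<and> l' = l then y else 1) * (if i' = i \<and> l' = l then z else 1)) \<le>
    real k ^ 3 + real k * (x + y + z) + (x * y + x * z + y * z + x * y * z)"
proof -
  let ?I = "{..<k} \<times> {..<k} \<times> {..<k}"
  let ?W = "x * y + x * z + y * z + x * y * z"
  have "(\<Sum>(i', j', l')\<in>?I. (if i' = i \<and> j' = j then x else 1) *
      (if j' = j \<and> l' = l then y else 1) * (if i' = i \<and> l' = l then z else 1)) \<le>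
    (\<Sum>(i', j', l')\<in>?I. 1 + (if i' = i then if j' = j then x else 0 else 0) + (if j' = j then if l' = l then y else 0 else 0) +
      (if i' = i then if l' = l then z else 0 else 0) + (if i' = i then if j' = j then if l' = l then ?W else 0 else 0 else 0))"
    using assms(1-3) by (intro sum_mono) (auto split: prod.split)
  also have "\<dots> = (\<Sum>i'<k. \<Sum>j'<k. \<Sum>l'<k. 1 + (if i' = i then if j' = j then x else 0 else 0) + (if j' = j then if l' = l then y else 0 else 0) +
      (if i' = i then if l' = l then z else 0 else 0) + (if i' = i then if j' = j then if l' = l then ?W else 0 else 0 else 0))"
    by (simp only: sum.cartesian_product[symmetric] split_conv)
  also have "\<dots> = real k ^ 3 + real k * (x + y + z) + ?W"
  proof -
    have *: "(\<Sum>j'<k. if P then f j' else 0) = (if P then \<Sum>j'<k. f j' else 0)" for P and f :: "nat \<Rightarrow> real" by simp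
    show ?thesis using t
      by (simp add: sum.distrib * power3_eq_cube algebra_simps flip: sum_distrib_left)
  qed
  finally show ?thesis .
qed

text \<open>
The variance is small compared with the squared mean if \<open>k\<^sup>2 p\<^sub>i\<close>, \<open>k\<^sup>3 p\<^sub>i p\<^sub>j\<close> and \<open>k\<^sup>3 p\<^sub>2 p\<^sub>3 p\<^sub>6\<close> are
all large. The last quantity is the expected number of triangles, and it is the only one that requires more
than lower bounds for the \<open>k p\<^sub>i\<close>.
\<close>

lemma prob_no_triangle_le:
  fixes q :: "nat \<Rightarrow> real"
  assumes q: "label_probabilities q" and k: "3 * k \<le> n" "0 < k"
    and d: "0 < d" "d \<le> k * q 2" "d \<le> k * q 3" "d \<le> k * q 6"
  shows "measure_pmf.prob (random_graph n q)
      {\<Gamma>. \<not> (\<exists>i<k. \<exists>j<k. \<exists>l<k. \<Gamma> {i, k + j} = Some 6 \<and> \<Gamma> {k + j, 2 * k + l} = Some 3 \<and> \<Gamma> {i, 2 * k + l} = Some 2)}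
    \<le> 3 / (k * d) + 3 / (k * d\<^sup>2) + 1 / (d\<^sup>2 * (k * q 6))"
proof -
  define E where "E t = {\<Gamma>. \<forall>e\<in>triangle_edges k t. \<Gamma> e = Some (triangle_label k e)}" for t
  let ?I = "{..<k} \<times> {..<k} \<times> {..<k}"
  define P where "P = q 6 * q 3 * q 2"
  have "0 < k * q 2" "0 < k * q 3" "0 < k * q 6" using d by linarith+
  then have pos: "0 < q 2" "0 < q 3" "0 < q 6" using k by (simp_all add: zero_less_mult_iff)
  then have P: "0 < P" by (simp add: P_def)
  define x y z where "x = 1 / q 6" and "y = 1 / q 3" and "z = 1 / q 2"
  have xyz: "0 \<le> x" "0 \<le> y" "0 \<le> z" using pos by (simp_all add: x_def y_def z_def)
  define \<eta> where "\<eta> = (x + y + z) / k ^ 2 + (x * y + x * z + y * z + x * y * z) / k ^ 3"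
  define m where "m = (\<Sum>t\<in>?I. measure_pmf.prob (random_graph n q) (E t))"
  have m: "m = real k ^ 3 * P"
  proof -
    have "m = (\<Sum>t\<in>?I. P)" unfolding m_def E_def P_def
      by (intro sum.cong) (use prob_two_triangles(1)[OF q pos k(1)] in auto)
    then show ?thesis by (simp add: power3_eq_cube)
  qed
  have "(\<Sum>t\<in>?I. \<Sum>t'\<in>?I. measure_pmf.prob (random_graph n q) (E t \<inter> E t')) \<le> (\<Sum>t\<in>?I. P\<^sup>2 * (real k ^ 3 * (1 + \<eta>)))"
  proof (rule sum_mono)
    fix t assume "t \<in> ?I"
    then obtain i j l where t: "t = (i, j, l)" "i < k" "j < k" "l < k" by auto
    have "(\<Sum>t'\<in>?I. measure_pmf.prob (random_graph n q) (E t \<inter> E t')) =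
      (\<Sum>(i', j', l')\<in>?I. P\<^sup>2 * ((if i' = i \<and> j' = j then x else 1) *
        (if j' = j \<and> l' = l then y else 1) * (if i' = i \<and> l' = l then z else 1)))"
      unfolding t(1) E_def P_def x_def y_def z_def
      by (intro sum.cong HOL.refl) (use prob_two_triangles(2)[OF q pos k(1) t(2-4)] in auto)
    also have "\<dots> = P\<^sup>2 * (\<Sum>(i', j', l')\<in>?I. (if i' = i \<and> j' = j then x else 1) *
        (if j' = j \<and> l' = l then y else 1) * (if i' = i \<and> l' = l then z else 1))"
      by (simp add: sum_distrib_left case_prod_unfold)
    also have "\<dots> \<le> P\<^sup>2 * (real k ^ 3 + real k * (x + y + z) + (x * y + x * z + y * z + x * y * z))"
      by (intro mult_left_mono overlap_sum_le xyz t) simp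
    also have "real k ^ 3 + real k * (x + y + z) + (x * y + x * z + y * z + x * y * z) = real k ^ 3 * (1 + \<eta>)"
      using k(2) by (simp add: \<eta>_def field_simps power2_eq_square power3_eq_cube)
    finally show "(\<Sum>t'\<in>?I. measure_pmf.prob (random_graph n q) (E t \<inter> E t')) \<le> P\<^sup>2 * (real k ^ 3 * (1 + \<eta>))" .
  qed
  also have "\<dots> = m\<^sup>2 * (1 + \<eta>)" unfolding m by (simp add: power3_eq_cube power2_eq_square)
  finally have second: "(\<Sum>t\<in>?I. \<Sum>t'\<in>?I. measure_pmf.prob (random_graph n q) (E t \<inter> E t')) \<le> m\<^sup>2 * (1 + \<eta>)" .
  have "{\<Gamma>. \<not> (\<exists>i<k. \<exists>j<k. \<exists>l<k. \<Gamma> {i, k + j} = Some 6 \<and> \<Gamma> {k + j, 2 * k + l} = Some 3 \<and> \<Gamma> {i, 2 * k + l} = Some 2)} =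
      {\<Gamma>. \<forall>t\<in>?I. \<Gamma> \<notin> E t}"
    by (auto simp: E_def triangle_edges_def triangle_label_values)
  moreover have "measure_pmf.prob (random_graph n q) {\<Gamma>. \<forall>t\<in>?I. \<Gamma> \<notin> E t} \<le> \<eta>"
    by (rule prob_no_event_le[OF _ m_def _ second]) (use m P k in auto)
  moreover have "\<eta> \<le> 3 / (k * d) + 3 / (k * d\<^sup>2) + 1 / (d\<^sup>2 * (k * q 6))"
  proof -
    define a b c where "a = k * q 6" and "b = k * q 3" and "c = k * q 2"
    have abc: "d \<le> a" "d \<le> b" "d \<le> c" using d by (simp_all add: a_def b_def c_def)
    have pos': "a > 0" "b > 0" "c > 0" "real k > 0" using abc d(1) k(2) by auto
    have xyz_eq: "x = k / a" "y = k / b" "z = k / c"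
      using k pos by (simp_all add: x_def y_def z_def a_def b_def c_def)
    have "x / k ^ 2 = 1 / (k * a)" "y / k ^ 2 = 1 / (k * b)" "z / k ^ 2 = 1 / (k * c)"
      "x * y / k ^ 3 = 1 / (k * (a * b))" "x * z / k ^ 3 = 1 / (k * (a * c))"
      "y * z / k ^ 3 = 1 / (k * (b * c))" "x * y * z / k ^ 3 = 1 / ((b * c) * a)"
      unfolding xyz_eq using pos' by (simp_all add: power2_eq_square power3_eq_cube)
    then have "\<eta> = (1 / (k * a) + 1 / (k * b) + 1 / (k * c)) +
        (1 / (k * (a * b)) + 1 / (k * (a * c)) + 1 / (k * (b * c))) + 1 / ((b * c) * a)"
      by (simp only: \<eta>_def add_divide_distrib)
    also have "\<dots> \<le> (1 / (k * d) + 1 / (k * d) + 1 / (k * d)) +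
        (1 / (k * (d * d)) + 1 / (k * (d * d)) + 1 / (k * (d * d))) + 1 / ((d * d) * a)"
      using abc d(1) k(2) by (intro add_mono divide_left_mono mult_mono mult_pos_pos) auto
    also have "\<dots> = 3 / (k * d) + 3 / (k * d\<^sup>2) + 1 / (d\<^sup>2 * a)" by (simp add: power2_eq_square mult.commute)
    finally show ?thesis unfolding a_def .
  qed
  ultimately show ?thesis by simp
qed

section \<open>Failure of hyperbolicity\<close>

lemma eventually_scaled_ge:
  fixes p :: "nat \<Rightarrow> real"
  assumes "liminf (\<lambda>n. ereal (real n * p n)) > 0"
  shows "\<exists>c>0. \<forall>\<^sub>F n in sequentially. c \<le> real n * p n"
proof -
  obtain c where c: "0 < c" "c < liminf (\<lambda>n. ereal (real n * p n))"
    using dense assms by blast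
  have "\<exists>d::real. 0 < d \<and> ereal d < liminf (\<lambda>n. ereal (real n * p n))"
  proof (cases c)
    case (real r)
    then show ?thesis using c by auto
  qed (use c in auto)
  then obtain d :: real where d: "0 < d" "ereal d < liminf (\<lambda>n. ereal (real n * p n))" by blast
  have "\<forall>\<^sub>F n in sequentially. d \<le> real n * p n"
    using less_LiminfD[OF d(2)] by (rule eventually_mono) simp
  then show ?thesis using d by blast
qed

theorem theorem9:
  fixes p :: "nat \<Rightarrow> nat \<Rightarrow> real"
  assumes "\<And>n. label_probabilities (\<lambda>m. p m n)"
    and "filterlim (\<lambda>n. real n * p 6 n) at_top sequentially"
    and "liminf (\<lambda>n. ereal (real n * p 3 n)) > 0"
    and "liminf (\<lambda>n. ereal (real n * p 2 n)) > 0"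
  shows "asymptotically_almost_surely (\<lambda>n. random_graph n (\<lambda>m. p m n))
           (\<lambda>n \<Gamma>. \<not> hyperbolic_group (coxeter_group {..<n} \<Gamma>))"
proof -
  obtain c3 where c3: "c3 > 0" "\<forall>\<^sub>F n in sequentially. c3 \<le> real n * p 3 n"
    using eventually_scaled_ge[OF assms(3)] by blast
  obtain c2 where c2: "c2 > 0" "\<forall>\<^sub>F n in sequentially. c2 \<le> real n * p 2 n"
    using eventually_scaled_ge[OF assms(4)] by blast
  define c where "c = min c2 c3"
  define d where "d = c / 6"
  have c: "0 < c" "c \<le> c2" "c \<le> c3" using c2 c3 by (auto simp: c_def)
  have d: "0 < d" using c by (simp add: d_def)
  define good where "good n = {\<Gamma>. \<not> hyperbolic_group (coxeter_group {..<n} \<Gamma>)}" for n :: nat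
  define \<eta> where "\<eta> n = 18 / (real n * d) + 18 / (real n * d\<^sup>2) + 6 / (d\<^sup>2 * (real n * p 6 n))" for n
  have "\<forall>\<^sub>F n in sequentially. c \<le> real n * p 6 n"
    using assms(2) by (simp add: filterlim_at_top)
  with c2(2) c3(2) eventually_ge_at_top[of 3]
  have lower: "\<forall>\<^sub>F n in sequentially. 1 - \<eta> n \<le> measure_pmf.prob (random_graph n (\<lambda>m. p m n)) (good n)"
  proof eventually_elim
    case (elim n)
    let ?\<mu> = "random_graph n (\<lambda>m. p m n)"
    \<comment> \<open>Three blocks of \<open>k\<close> vertices; the bounds for \<open>n p\<^sub>i\<close> lose at most a factor 6 on passing to \<open>k p\<^sub>i\<close>.\<close>
    define k where "k = n div 3"
    have div: "n = 3 * k + n mod 3" "n mod 3 < 3" unfolding k_def by simp_all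
    then have "0 < k" using elim(3) by linarith
    with div have k: "3 * k \<le> n" "0 < k" "n \<le> 6 * k" by linarith+
    have "0 < real n * p 2 n" "0 < real n * p 3 n" "0 < real n * p 6 n"
      using elim c c2 c3 by linarith+
    then have pos: "0 < p 2 n" "0 < p 3 n" "0 < p 6 n" by (simp_all add: zero_less_mult_iff)
    have scale: "real n * x \<le> 6 * (real k * x)" if "0 < x" for x
      using mult_right_mono[of "real n" "6 * real k" x] k that by simp
    have le: "d \<le> real k * p 2 n" "d \<le> real k * p 3 n" "d \<le> real k * p 6 n"
      using scale[OF pos(1)] scale[OF pos(2)] scale[OF pos(3)] elim c unfolding d_def by linarith+
    define N where "N = {\<Gamma>. \<not> (\<exists>i<k. \<exists>j<k. \<exists>l<k. \<Gamma> {i, k + j} = Some 6 \<and> \<Gamma> {k + j, 2 * k + l} = Some 3 \<and>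
        \<Gamma> {i, 2 * k + l} = Some (2::nat))}"
    have "measure_pmf.prob ?\<mu> N \<le> 3 / (k * d) + 3 / (k * d\<^sup>2) + 1 / (d\<^sup>2 * (k * p 6 n))"
      unfolding N_def using prob_no_triangle_le[OF assms(1) k(1,2) d le] .
    also have "\<dots> \<le> \<eta> n"
    proof -
      have inv: "1 / (real k * x) \<le> 6 / (real n * x)" if "0 < x" for x :: real
      proof -
        have "6 / (6 * (real k * x)) \<le> 6 / (real n * x)"
          using scale[OF that] that elim(3) by (intro divide_left_mono mult_pos_pos) (use k in auto)
        then show ?thesis by simp
      qed
      have "3 * (1 / (k * d)) \<le> 3 * (6 / (n * d))" using inv[OF d] by linarith
      then have "3 / (k * d) \<le> 18 / (n * d)" by simp
      moreover have "3 * (1 / (k * d\<^sup>2)) \<le> 3 * (6 / (n * d\<^sup>2))" using inv[of "d\<^sup>2"] d by simp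
      then have "3 / (k * d\<^sup>2) \<le> 18 / (n * d\<^sup>2)" by simp
      moreover have "1 / (d\<^sup>2 * (k * p 6 n)) \<le> 6 / (d\<^sup>2 * (n * p 6 n))"
      proof -
        have comm: "d\<^sup>2 * (real i * p 6 n) = real i * (d\<^sup>2 * p 6 n)" for i :: nat
          by (rule mult.left_commute)
        show ?thesis unfolding comm using d pos by (intro inv) simp
      qed
      ultimately show ?thesis unfolding \<eta>_def by linarith
    qed
    finally have "measure_pmf.prob ?\<mu> N \<le> \<eta> n" .
    moreover have "1 - measure_pmf.prob ?\<mu> N = measure_pmf.prob ?\<mu> (- N)"
      using measure_pmf.prob_compl[of N ?\<mu>] by (simp add: Compl_eq_Diff_UNIV[symmetric])
    moreover have "measure_pmf.prob ?\<mu> (- N) \<le> measure_pmf.prob ?\<mu> (good n)"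
    proof (rule measure_pmf.finite_measure_mono_AE)
      show "AE \<Gamma> in measure_pmf ?\<mu>. \<Gamma> \<in> - N \<longrightarrow> \<Gamma> \<in> good n"
      proof (rule AE_pmfI, rule impI)
        fix \<Gamma> assume \<Gamma>: "\<Gamma> \<in> set_pmf ?\<mu>" "\<Gamma> \<in> - N"
        then obtain i j l where ijl: "i < k" "j < k" "l < k" "\<Gamma> {i, k + j} = Some 6"
          "\<Gamma> {k + j, 2 * k + l} = Some 3" "\<Gamma> {i, 2 * k + l} = Some 2" unfolding N_def by blast
        interpret euclidean_triangle "{..<n}" \<Gamma> i "k + j" "2 * k + l"
          using ijl k random_graph_labels_ge_2[OF assms(1) \<Gamma>(1)] by unfold_locales auto
        show "\<Gamma> \<in> good n" using not_hyperbolic by (simp add: good_def)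
      qed
    qed simp
    ultimately show ?case by linarith
  qed
  have "\<eta> \<longlonglongrightarrow> 0"
  proof -
    have "filterlim (\<lambda>n. d\<^sup>2 * (real n * p 6 n)) at_top sequentially"
      using d by (intro filterlim_tendsto_pos_mult_at_top[OF tendsto_const _ assms(2)]) simp
    then have "(\<lambda>n. 6 / (d\<^sup>2 * (real n * p 6 n))) \<longlonglongrightarrow> 0"
      by (intro tendsto_divide_0[OF tendsto_const] filterlim_at_top_imp_at_infinity)
    moreover have "(\<lambda>n. 18 / (real n * d)) \<longlonglongrightarrow> 0" "(\<lambda>n. 18 / (real n * d\<^sup>2)) \<longlonglongrightarrow> 0"
      using d by real_asymp+
    ultimately have "(\<lambda>n. 18 / (real n * d) + 18 / (real n * d\<^sup>2) + 6 / (d\<^sup>2 * (real n * p 6 n))) \<longlonglongrightarrow> 0 + 0 + 0"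
      by (intro tendsto_add)
    then show ?thesis unfolding \<eta>_def by simp
  qed
  then have lim: "(\<lambda>n. 1 - \<eta> n) \<longlonglongrightarrow> 1" using tendsto_diff[OF tendsto_const[of 1], of \<eta> 0] by simp
  have "(\<lambda>n. measure_pmf.prob (random_graph n (\<lambda>m. p m n)) (good n)) \<longlonglongrightarrow> 1"
  proof (rule tendsto_sandwich[OF lower _ lim tendsto_const])
    show "\<forall>\<^sub>F n in sequentially. measure_pmf.prob (random_graph n (\<lambda>m. p m n)) (good n) \<le> 1"
      by (intro always_eventually allI measure_pmf.prob_le_1)
  qed
  then show ?thesis unfolding asymptotically_almost_surely_def good_def .
qed

end
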